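(* Let $G$ be a connected graph on $n\geq 13$ vertices with minimum degree $\delta\geq 3$. If $$q(G)\geq q(S_{n}^{3}),$$ then $G$ is Hamilton-connected unless $G=S_{n}^{3}$.
   Context: All graphs are finite and simple (no loops or multiple edges); equality of graphs is up to isomorphism. $\delta=\delta(G)$ is the minimum degree of $G$. $q(G)$ is the signless Laplacian spectral radius of $G$, i.e. the largest eigenvalue of $Q(G)=D(G)+A(G)$, where $A(G)$ is the adjacency matrix and $D(G)$ the diagonal matrix of vertex degrees of $G$. A Hamilton path is a path containing all vertices of $G$; $G$ is Hamilton-connected if every two (distinct) vertices of $G$ are connected by a Hamilton path. $G+H$ and $G\vee H$ denote the disjoint union and the join of $G$ and $H$; $kG$ is the disjoint union of $k$ copies of $G$; $K_n$ is the complete graph on $n$ vertices. The graph $S_n^3$ is $$S_{n}^{3}=K_{3}\vee (K_{n-5}+2K_{1}).$$ *)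

theory Defs
  imports
    "HOL-Library.Countable_Set"
    "Graph_Theory.Graph_Theory"
    "Jordan_Normal_Form.Spectral_Radius"
begin

text \<open>
  A finite simple graph is a \<^locale>\<open>pair_graph\<close>: finite vertex set, and an irreflexive, symmetric
  set of arcs, so that an undirected edge \<open>uv\<close> is the pair of arcs \<open>(u, v)\<close> and \<open>(v, u)\<close>, and the
  degree of a vertex is its \<^const>\<open>out_degree\<close>.
\<close>

subsection \<open>Graph constructions\<close>

definition complete_graph :: "nat \<Rightarrow> nat pair_pre_digraph" where
  "complete_graph n = \<lparr>pverts = {..<n}, parcs = {(i, j). i < n \<and> j < n \<and> i \<noteq> j}\<rparr>"

definition disjoint_union ::
    "'a pair_pre_digraph \<Rightarrow> 'b pair_pre_digraph \<Rightarrow> ('a + 'b) pair_pre_digraph" where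
  "disjoint_union G H =
    \<lparr>pverts = pverts G <+> pverts H,
     parcs = map_prod Inl Inl ` parcs G \<union> map_prod Inr Inr ` parcs H\<rparr>"

definition graph_join ::
    "'a pair_pre_digraph \<Rightarrow> 'b pair_pre_digraph \<Rightarrow> ('a + 'b) pair_pre_digraph" where
  "graph_join G H =
    \<lparr>pverts = pverts G <+> pverts H,
     parcs = parcs (disjoint_union G H)
       \<union> (Inl ` pverts G) \<times> (Inr ` pverts H) \<union> (Inr ` pverts H) \<times> (Inl ` pverts G)\<rparr>"

definition copies :: "nat \<Rightarrow> 'a pair_pre_digraph \<Rightarrow> (nat \<times> 'a) pair_pre_digraph" where
  "copies k G =
    \<lparr>pverts = {..<k} \<times> pverts G,
     parcs = {((i, u), (j, v)). i < k \<and> i = j \<and> (u, v) \<in> parcs G}\<rparr>"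

text \<open>The subtraction truncates; the graph has \<open>n\<close> vertices only for \<open>n \<ge> 5\<close>.\<close>

definition S3 :: "nat \<Rightarrow> (nat + nat + nat \<times> nat) pair_pre_digraph" where
  "S3 n = graph_join (complete_graph 3)
     (disjoint_union (complete_graph (n - 5)) (copies 2 (complete_graph 1)))"

subsection \<open>Minimum degree and Hamilton-connectedness\<close>

definition min_degree :: "'a pair_pre_digraph \<Rightarrow> nat" where
  "min_degree G = Min (out_degree (with_proj G) ` pverts G)"

definition hamilton_path ::
    "'a pair_pre_digraph \<Rightarrow> 'a \<Rightarrow> ('a \<times> 'a) awalk \<Rightarrow> 'a \<Rightarrow> bool" where
  "hamilton_path G u p v \<longleftrightarrow>
    pre_digraph.apath (with_proj G) u p v \<and>
    set (pre_digraph.awalk_verts (with_proj G) u p) = pverts G"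

definition hamilton_connected :: "'a pair_pre_digraph \<Rightarrow> bool" where
  "hamilton_connected G \<longleftrightarrow>
    (\<forall>u\<in>pverts G. \<forall>v\<in>pverts G. u \<noteq> v \<longrightarrow> (\<exists>p. hamilton_path G u p v))"

subsection \<open>Signless Laplacian\<close>

text \<open>
  Matrices are indexed by \<open>{..<n}\<close>, hence the vertices are enumerated by \<^const>\<open>from_nat_into\<close>, a
  bijection from \<open>{..<card V}\<close> to \<open>V\<close> for every finite \<open>V\<close>. Another enumeration conjugates the
  matrices by a permutation matrix, which leaves the eigenvalues unchanged.
\<close>

definition adjacency_mat :: "'a pair_pre_digraph \<Rightarrow> real mat" where
  "adjacency_mat G = mat (card (pverts G)) (card (pverts G))
     (\<lambda>(i, j). if (from_nat_into (pverts G) i, from_nat_into (pverts G) j) \<in> parcs G then 1 else 0)"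

definition degree_mat :: "'a pair_pre_digraph \<Rightarrow> real mat" where
  "degree_mat G = mat_diag (card (pverts G))
     (\<lambda>i. real (out_degree (with_proj G) (from_nat_into (pverts G) i)))"

definition signless_laplacian :: "'a pair_pre_digraph \<Rightarrow> real mat" where
  "signless_laplacian G = degree_mat G + adjacency_mat G"

text \<open>The matrix is real symmetric, so its spectrum is already exhausted by the real eigenvalues.\<close>

definition signless_laplacian_radius :: "'a pair_pre_digraph \<Rightarrow> real" where
  "signless_laplacian_radius G = Max (spectrum (signless_laplacian G))"

end

theory Submission
  imports Defs "HOL-Analysis.Function_Topology"
begin

text \<open>A graph that is not Hamilton-connected has few large degrees, and the signless Laplacian radius
  \<open>q\<close> is sensitive enough to degrees to exclude all such graphs but one.

  Combinatorial half. Hamilton-connectedness of a graph on \<open>n\<close> vertices does not change when an edge is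
  added between two nonadjacent vertices of degree sum at least \<open>n + 1\<close>. Hence a graph that is not
  Hamilton-connected lies in an edge-maximal one in which nonadjacent vertices have degree sum at
  most \<open>n\<close>, and a nonadjacent pair of maximal degree sum there yields Berge's degree condition
  (\<open>low_degrees_if_not_ham_conn\<close>): for some \<open>k\<close> between the minimum degree and \<open>n / 2\<close> there are
  \<open>n - k\<close> vertices of degree at most \<open>n - k\<close>, and \<open>k - 1\<close> of them even have degree at most \<open>k\<close>.
  Here \<open>k \<ge> 3\<close>.

  Spectral half. The form \<open>\<Sum>(x v + x w)\<^sup>2\<close>, taken over all edges \<open>vw\<close>, is that of \<open>D + A\<close>, so \<open>q\<close> is
  its maximum on the unit sphere and is attained at a nonnegative vector. The vector that is
  constant on the clique \<open>K\<^bsub>n-2\<^esub>\<close> of \<open>S\<^sub>n\<^sup>3\<close> shows \<open>q(S\<^sub>n\<^sup>3) \<ge> 2n - 6 + 6/(n - 2)\<close>. In the other direction,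
  \<open>q \<le> c\<close> follows from any positive \<open>y\<close> with \<open>(D + A) y \<le> c y\<close> (\<open>signless_eigen_le\<close>).

  The case \<open>k \<ge> 4\<close>. With \<open>y\<close> the degree vector, a degree sum of at most \<open>n\<^sup>2 - 5n + 10\<close> gives
  \<open>q \<le> 2n - 6 + 6/(n - 1)\<close>, which is below \<open>q(S\<^sub>n\<^sup>3)\<close>. The degree condition forces such a sum as soon as
  \<open>n \<ge> 13\<close>, which is exactly what \<open>k = 4\<close> needs, with two exceptions: \<open>n = 13, k = 6\<close> and
  \<open>n = 14, k = 7\<close>. In both there are seven vertices of degree at most 7, and a vector \<open>y\<close> with one
  value on these and another value elsewhere gives a sufficient bound.

  The case \<open>k = 3\<close>. Two vertices \<open>u\<close>, \<open>w\<close> have degree 3 and at most three vertices have degree above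
  \<open>n - 3\<close>. Let \<open>x\<close> be a nonnegative eigenvector of \<open>G\<close> for \<open>q(G)\<close>. Completing \<open>G - {u, w}\<close> to a clique
  and joining \<open>u\<close> and \<open>w\<close> to the three vertices of that clique where \<open>x\<close> is largest turns \<open>G\<close> into a
  copy of \<open>S\<^sub>n\<^sup>3\<close> and does not decrease the form at \<open>x\<close>. Since \<open>q(G) \<ge> q(S\<^sub>n\<^sup>3)\<close>, nothing can have
  increased: \<open>x\<close> is an eigenvector of that copy too, hence positive, so no edge inside the clique was
  missing and \<open>u\<close>, \<open>w\<close> were not adjacent. Every neighbour of \<open>u\<close> or \<open>w\<close> then has degree above \<open>n - 3\<close>,
  so \<open>u\<close> and \<open>w\<close> have the same three neighbours and \<open>G\<close> is \<open>S\<^sub>n\<^sup>3\<close>.\<close>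

section \<open>Hamilton-connectedness and vertex degrees\<close>

lemma ex_maximizer:
  fixes f :: "'a \<Rightarrow> 'b :: linorder"
  assumes "finite S" "S \<noteq> {}"
  shows "\<exists>z\<in>S. \<forall>v\<in>S. f v \<le> f z"
proof -
  have "Max (f ` S) \<in> f ` S"
    using assms by (intro Max_in) auto
  then obtain z where "z \<in> S" "Max (f ` S) = f z"
    by auto
  then show ?thesis
    using Max_ge[of "f ` S"] assms(1) by (intro bexI[of _ z]) auto
qed

text \<open>Vertex set and arc relation are kept apart, so that graphs with the same vertices can be compared
  through inclusion of their arcs and edges can be added one at a time.\<close>
locale simple_graph =
  fixes V :: "'a set" and E :: "'a rel"
  assumes finite_verts: "finite V"
    and arcs_subset: "E \<subseteq> V \<times> V"
    and sym_arcs: "sym E"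
    and irrefl_arcs: "irrefl E"

abbreviation valency :: "'a rel \<Rightarrow> 'a \<Rightarrow> nat" where
  "valency E v \<equiv> card (E `` {v})"

text \<open>Hamilton paths as vertex lists: reversing a segment, the step on which the closure argument
  rests, is then plain list surgery.\<close>
definition ham_path :: "'a set \<Rightarrow> 'a rel \<Rightarrow> 'a \<Rightarrow> 'a list \<Rightarrow> 'a \<Rightarrow> bool" where
  "ham_path V E a xs b \<longleftrightarrow> xs \<noteq> [] \<and> hd xs = a \<and> last xs = b \<and> distinct xs \<and> set xs = V \<and>
     successively (\<lambda>x y. (x, y) \<in> E) xs"

definition ham_conn :: "'a set \<Rightarrow> 'a rel \<Rightarrow> bool" where
  "ham_conn V E \<longleftrightarrow> (\<forall>a\<in>V. \<forall>b\<in>V. a \<noteq> b \<longrightarrow> (\<exists>xs. ham_path V E a xs b))"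

lemma not_successively_split:
  assumes "\<not> successively R xs"
  obtains ys c d zs where "xs = ys @ c # d # zs" "\<not> R c d"
proof -
  have "\<exists>ys c d zs. xs = ys @ c # d # zs \<and> \<not> R c d"
    using assms
  proof (induction R xs rule: successively.induct)
    case (3 R x y xs)
    show ?case
    proof (cases "R x y")
      case True
      then obtain ys c d zs where "y # xs = ys @ c # d # zs" "\<not> R c d"
        using 3 by auto
      then show ?thesis
        by (metis append_Cons)
    qed (metis append_Nil)
  qed auto
  then show thesis
    using that by blast
qed

lemma successively_append:
  assumes "successively R xs" "successively R ys"
    and "xs \<noteq> [] \<Longrightarrow> ys \<noteq> [] \<Longrightarrow> R (last xs) (hd ys)"
  shows "successively R (xs @ ys)"
  using assms by (auto simp: successively_append_iff)

text \<open>Each of the \<open>length xs - 1\<close> consecutive pairs accounts for at most one of the two counts. Only the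
  last entry for \<open>P\<close> and the first entry for \<open>Q\<close> are not covered by a pair.\<close>
lemma length_filter_successively_le:
  assumes "xs \<noteq> []" "successively (\<lambda>c d. \<not> (P c \<and> Q d)) xs"
  shows "length (filter P xs) + length (filter Q xs) + 1
    \<le> length xs + of_bool (P (last xs)) + of_bool (Q (hd xs))"
  using assms by (induction xs rule: induct_list012) (auto split: if_splits)

lemma (in simple_graph) finite_neighbours [simp]: "finite (E `` A)"
  by (rule finite_subset[OF _ finite_verts]) (use arcs_subset in auto)

lemma degree_le_filters:
  assumes "distinct (xs @ ys)" "E `` {w} \<subseteq> set (xs @ ys)"
  shows "valency E w \<le> length (filter (\<lambda>x. (w, x) \<in> E) xs) + length (filter (\<lambda>x. (w, x) \<in> E) ys)"
proof -
  have "E `` {w} = set (filter (\<lambda>x. (w, x) \<in> E) (xs @ ys))"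
    using assms(2) by auto
  then have "valency E w \<le> length (filter (\<lambda>x. (w, x) \<in> E) (xs @ ys))"
    by (metis card_length)
  then show ?thesis by simp
qed

text \<open>Removing \<open>uv\<close> leaves a piece ending in \<open>u\<close> and a piece starting in \<open>v\<close>. If one of the pieces
  contains consecutive vertices \<open>c\<close>, \<open>d\<close> with \<open>uc\<close> and \<open>vd\<close> edges, reversing the part between them and
  the gap gives a Hamilton path with the same ends. If neither piece contains such a pair, counting
  the neighbours of \<open>u\<close> and of \<open>v\<close> along both pieces gives degree sum at most the number of vertices.\<close>
lemma (in simple_graph) ham_path_drop_arc:
  assumes path: "ham_path V (insert (u, v) (insert (v, u) E)) a (ys @ u # v # zs) b"
    and nonadj: "(u, v) \<notin> E"
    and deg: "card V < valency E u + valency E v"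
  shows "\<exists>xs. ham_path V E a xs b"
proof -
  let ?E' = "insert (u, v) (insert (v, u) E)"
  let ?P = "ys @ [u]" and ?Q = "v # zs"
  let ?R = "\<lambda>x y. (x, y) \<in> E"
  let ?N = "\<lambda>c d. \<not> ((u, c) \<in> E \<and> (v, d) \<in> E)"
  have dist: "distinct (?P @ ?Q)" and verts: "set (?P @ ?Q) = V"
    and succ: "successively (\<lambda>x y. (x, y) \<in> ?E') (?P @ ?Q)"
    and ends: "hd (?P @ ?Q) = a" "last (?P @ ?Q) = b"
    using path by (auto simp: ham_path_def)
  have sym: "(x, y) \<in> E \<longleftrightarrow> (y, x) \<in> E" for x y
    using sym_arcs by (meson symE)
  have no_loop: "(x, x) \<notin> E" for x
    using irrefl_arcs by (meson irreflD)
  have P: "successively ?R ?P"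
  proof (rule successively_mono[of "\<lambda>x y. (x, y) \<in> ?E'"])
    show "successively (\<lambda>x y. (x, y) \<in> ?E') ?P"
      using succ unfolding successively_append_iff by simp
  qed (use dist in auto)
  have Q: "successively ?R ?Q"
  proof (rule successively_mono[of "\<lambda>x y. (x, y) \<in> ?E'"])
    show "successively (\<lambda>x y. (x, y) \<in> ?E') ?Q"
      using succ unfolding successively_append_iff by simp
  qed (use dist in auto)
  have rev: "successively ?R (rev L)" if "successively ?R L" for L
    using that sym by (simp add: successively_rev)
  have "\<not> (successively ?N ?P \<and> successively ?N ?Q)"
  proof
    assume N: "successively ?N ?P \<and> successively ?N ?Q"
    define fP gP fQ gQ where "fP = length (filter (\<lambda>x. (u, x) \<in> E) ?P)"
      and "gP = length (filter (\<lambda>x. (v, x) \<in> E) ?P)"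
      and "fQ = length (filter (\<lambda>x. (u, x) \<in> E) ?Q)"
      and "gQ = length (filter (\<lambda>x. (v, x) \<in> E) ?Q)"
    have ob: "of_bool c \<le> (1 :: nat)" for c
      by simp
    have "fP + gP + 1 \<le> length ?P + 1"
      using length_filter_successively_le[of ?P "\<lambda>x. (u, x) \<in> E" "\<lambda>x. (v, x) \<in> E"] N no_loop[of u]
        ob[of "(v, hd ?P) \<in> E"]
      unfolding fP_def gP_def by (simp del: filter_append length_append)
    moreover have "fQ + gQ + 1 \<le> length ?Q + 1"
      using length_filter_successively_le[of ?Q "\<lambda>x. (u, x) \<in> E" "\<lambda>x. (v, x) \<in> E"] N no_loop[of v]
        ob[of "(u, last ?Q) \<in> E"]
      unfolding fQ_def gQ_def by (simp del: filter.simps)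
    moreover have "valency E u \<le> fP + fQ"
      unfolding fP_def fQ_def by (rule degree_le_filters[OF dist]) (use arcs_subset verts in auto)
    moreover have "valency E v \<le> gP + gQ"
      unfolding gP_def gQ_def by (rule degree_le_filters[OF dist]) (use arcs_subset verts in auto)
    moreover have "card V = length ?P + length ?Q"
      using distinct_card[OF dist] verts by simp
    ultimately show False
      using deg by linarith
  qed
  then consider "\<not> successively ?N ?P" | "\<not> successively ?N ?Q"
    by blast
  then show ?thesis
  proof cases
    case 1
    then obtain L c d M where L: "?P = L @ c # d # M" and cd: "(u, c) \<in> E" "(v, d) \<in> E"
      by (rule not_successively_split) blast
    have u: "last (d # M) = u"
      using arg_cong[OF L, of last] by simp
    have cd': "(c, u) \<in> E" "(d, v) \<in> E"
      using cd sym by blast+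
    have LM: "successively ?R (L @ [c])" "successively ?R (d # M)"
      using P unfolding L by (auto simp: successively_append_iff successively_Cons)
    \<comment> \<open>The new path runs to \<open>c\<close>, jumps to \<open>u\<close>, runs back to \<open>d\<close> and jumps to \<open>v\<close>.\<close>
    have "successively ?R ((L @ [c]) @ rev (d # M) @ ?Q)"
      by (rule successively_append[OF LM(1) successively_append[OF rev[OF LM(2)] Q]]) (use cd' u in \<open>auto simp: hd_append hd_rev last_rev\<close>)
    moreover have "set ((L @ [c]) @ rev (d # M) @ ?Q) = V" "distinct ((L @ [c]) @ rev (d # M) @ ?Q)"
      using verts dist unfolding L by auto
    moreover have "hd ((L @ [c]) @ rev (d # M) @ ?Q) = a" "last ((L @ [c]) @ rev (d # M) @ ?Q) = b"
      using ends unfolding L by (cases L; simp)+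
    ultimately show ?thesis
      unfolding ham_path_def by blast
  next
    case 2
    then obtain L c d M where L: "?Q = L @ c # d # M" and cd: "(u, c) \<in> E" "(v, d) \<in> E"
      by (rule not_successively_split) blast
    have v: "hd (L @ [c]) = v"
      using arg_cong[OF L, of hd] by (cases L) auto
    have LM: "successively ?R (L @ [c])" "successively ?R (d # M)"
      using Q unfolding L by (auto simp: successively_append_iff successively_Cons)
    \<comment> \<open>The new path runs to \<open>u\<close>, jumps to \<open>c\<close>, runs back to \<open>v\<close> and jumps to \<open>d\<close>.\<close>
    have "successively ?R (?P @ rev (L @ [c]) @ d # M)"
      by (rule successively_append[OF P successively_append[OF rev[OF LM(1)] LM(2)]]) (use cd v in \<open>auto simp: hd_append hd_rev last_rev\<close>)
    moreover have "set (?P @ rev (L @ [c]) @ d # M) = V" "distinct (?P @ rev (L @ [c]) @ d # M)"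
      using verts dist unfolding L by auto
    moreover have "hd (?P @ rev (L @ [c]) @ d # M) = a" "last (?P @ rev (L @ [c]) @ d # M) = b"
      using ends unfolding L by (cases ys; simp)+
    ultimately show ?thesis
      unfolding ham_path_def by blast
  qed
qed

lemma (in simple_graph) ham_conn_insert_edge:
  assumes "(u, v) \<notin> E" "card V < valency E u + valency E v"
    and "ham_conn V (insert (u, v) (insert (v, u) E))"
  shows "ham_conn V E"
  unfolding ham_conn_def
proof (intro ballI impI)
  let ?E' = "insert (u, v) (insert (v, u) E)"
  fix a b assume "a \<in> V" "b \<in> V" "a \<noteq> b"
  then obtain xs where xs: "ham_path V ?E' a xs b"
    using assms(3) unfolding ham_conn_def by blast
  show "\<exists>xs. ham_path V E a xs b"
  proof (cases "successively (\<lambda>x y. (x, y) \<in> E) xs")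
    case True
    then show ?thesis
      using xs unfolding ham_path_def by blast
  next
    case False
    then obtain ys c d zs where split: "xs = ys @ c # d # zs" and cd: "(c, d) \<notin> E"
      using not_successively_split by blast
    have "(c, d) \<in> ?E'"
      using xs unfolding split ham_path_def by (simp add: successively_append_iff successively_Cons)
    then consider "c = u" "d = v" | "c = v" "d = u"
      using cd by blast
    then show ?thesis
    proof cases
      case 1
      then show ?thesis
        using ham_path_drop_arc[of u v a ys zs b] xs assms split by simp
    next
      case 2
      have "(v, u) \<notin> E"
        using assms(1) sym_arcs by (meson symE)
      then show ?thesis
        using ham_path_drop_arc[of v u a ys zs b] xs assms split 2 by (simp add: insert_commute add.commute)
    qed
  qed
qed

lemma ham_conn_complete:
  assumes "finite V" "\<And>u v. u \<in> V \<Longrightarrow> v \<in> V \<Longrightarrow> u \<noteq> v \<Longrightarrow> (u, v) \<in> E"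
  shows "ham_conn V E"
  unfolding ham_conn_def
proof (intro ballI impI)
  fix a b assume ab: "a \<in> V" "b \<in> V" "a \<noteq> b"
  obtain zs where zs: "set zs = V - {a, b}" "distinct zs"
    using finite_distinct_list[of "V - {a, b}"] assms(1) by auto
  have "successively (\<lambda>x y. (x, y) \<in> E) xs" if "distinct xs" "set xs \<subseteq> V" for xs
    using that by (induction xs rule: induct_list012) (auto intro: assms(2))
  then have "ham_path V E a (a # zs @ [b]) b"
    using ab zs unfolding ham_path_def by auto
  then show "\<exists>xs. ham_path V E a xs b" ..
qed

text \<open>In an edge-maximal such graph, joining any nonadjacent pair makes the graph Hamilton-connected, so
  \<open>ham_conn_insert_edge\<close> bounds the degree sum of the pair.\<close>
lemma (in simple_graph) maximal_not_ham_conn: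
  assumes "\<not> ham_conn V E"
  obtains F where "simple_graph V F" "E \<subseteq> F" "\<not> ham_conn V F"
    "\<And>u v. u \<in> V \<Longrightarrow> v \<in> V \<Longrightarrow> u \<noteq> v \<Longrightarrow> (u, v) \<notin> F \<Longrightarrow> valency F u + valency F v \<le> card V"
proof -
  let ?S = "{F. simple_graph V F \<and> \<not> ham_conn V F}"
  have "?S \<subseteq> Pow (V \<times> V)"
    by (auto simp: simple_graph_def)
  then have "finite ?S"
    using finite_verts by (meson finite_Pow_iff finite_SigmaI finite_subset)
  moreover have "E \<in> ?S"
    using assms simple_graph_axioms by simp
  ultimately obtain F where F: "F \<in> ?S" "E \<subseteq> F" and max: "\<And>F'. F' \<in> ?S \<Longrightarrow> F \<subseteq> F' \<Longrightarrow> F' = F"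
    using finite_has_maximal2[of ?S E] by metis
  show thesis
  proof (rule that)
    fix u v assume uv: "u \<in> V" "v \<in> V" "u \<noteq> v" "(u, v) \<notin> F"
    let ?F' = "insert (u, v) (insert (v, u) F)"
    have "simple_graph V ?F'"
      using F(1) uv unfolding simple_graph_def sym_def irrefl_def by auto
    then have "ham_conn V ?F'"
      using max[of ?F'] uv(4) by blast
    then show "valency F u + valency F v \<le> card V"
      using simple_graph.ham_conn_insert_edge[of V F u v] F(1) uv(4) by force
  qed (use F in auto)
qed

text \<open>Berge's degree condition. In an edge-maximal supergraph take a nonadjacent pair \<open>u\<close>, \<open>v\<close> of largest
  degree sum, with \<open>u\<close> of the smaller degree \<open>k\<close>. By the choice of the pair, all non-neighbours of \<open>v\<close>
  have degree at most \<open>k\<close>, and all non-neighbours of \<open>u\<close> have degree at most that of \<open>v\<close>, hence at most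
  \<open>n - k\<close>. There are enough of both kinds because the degree sum of the pair is at most \<open>n\<close>. Degrees in
  the given graph are no larger. The two sets are returned nested, which is what the degree sum
  estimate needs.\<close>
theorem (in simple_graph) low_degrees_if_not_ham_conn:
  assumes not_hc: "\<not> ham_conn V E" and mindeg: "\<And>v. v \<in> V \<Longrightarrow> m \<le> valency E v" and m: "0 < m"
  obtains k A D where "m \<le> k" "2 * k \<le> card V" "A \<subseteq> D" "D \<subseteq> V"
    "card A = k - 1" "card D = card V - k"
    "\<And>v. v \<in> A \<Longrightarrow> valency E v \<le> k" "\<And>v. v \<in> D \<Longrightarrow> valency E v \<le> card V - k"
proof -
  obtain F where "simple_graph V F" and EF: "E \<subseteq> F" and F_hc: "\<not> ham_conn V F"
    and F_closed: "\<And>u v. u \<in> V \<Longrightarrow> v \<in> V \<Longrightarrow> u \<noteq> v \<Longrightarrow> (u, v) \<notin> F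
      \<Longrightarrow> valency F u + valency F v \<le> card V"
    using maximal_not_ham_conn[OF not_hc] by blast
  interpret F: simple_graph V F by fact
  have le_F: "valency E w \<le> valency F w" for w
    using EF by (intro card_mono) auto
  have F_sym: "(x, y) \<in> F \<longleftrightarrow> (y, x) \<in> F" for x y
    using F.sym_arcs by (meson symE)
  have F_irr: "(x, x) \<notin> F" for x
    using F.irrefl_arcs by (meson irreflD)
  let ?S = "{(u, v). u \<in> V \<and> v \<in> V \<and> u \<noteq> v \<and> (u, v) \<notin> F}"
  let ?s = "\<lambda>(u, v). valency F u + valency F v"
  have "finite ?S"
    by (rule finite_subset[of _ "V \<times> V"]) (use finite_verts in auto)
  moreover have "?S \<noteq> {}"
    using ham_conn_complete[OF finite_verts, of F] F_hc by auto
  ultimately obtain p where p: "p \<in> ?S" "\<And>p'. p' \<in> ?S \<Longrightarrow> ?s p' \<le> ?s p"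
    using ex_maximizer[of ?S ?s] by blast
  obtain u0 v0 where "p = (u0, v0)"
    by fastforce
  with p have uv0: "(u0, v0) \<in> ?S" and max0: "\<And>p'. p' \<in> ?S \<Longrightarrow> ?s p' \<le> ?s (u0, v0)"
    by blast+
  obtain u v where uv: "(u, v) \<in> ?S" and max: "\<And>p'. p' \<in> ?S \<Longrightarrow> ?s p' \<le> ?s (u, v)"
    and le: "valency F u \<le> valency F v"
  proof (cases "valency F u0 \<le> valency F v0")
    case True
    then show ?thesis using that[OF uv0 max0] by auto
  next
    case False
    have "(v0, u0) \<in> ?S"
      using uv0 F_sym by auto
    moreover have "?s (v0, u0) = ?s (u0, v0)" by simp
    ultimately show ?thesis
      using that[of v0 u0] max0 False by fastforce
  qed
  define k where "k = valency F u"
  have V: "u \<in> V" "v \<in> V" "u \<noteq> v" "(u, v) \<notin> F"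
    using uv by auto
  have sum: "valency F u + valency F v \<le> card V"
    using F_closed V by blast
  have mk: "m \<le> k"
    using mindeg[OF V(1)] le_F[of u] unfolding k_def by linarith
  define A0 where "A0 = V - {v} - F `` {v}"
  define C0 where "C0 = V - F `` {u} - {v}"
  have A0_deg: "valency F w \<le> k" if "w \<in> A0" for w
    using max[of "(w, v)"] that V F_sym unfolding A0_def k_def by auto
  have C0_deg: "valency F w \<le> card V - k" if "w \<in> C0 \<union> {v}" for w
  proof (cases "w = u \<or> w = v")
    case True
    then show ?thesis using sum le unfolding k_def by auto
  next
    case False
    then have "valency F w \<le> valency F v"
      using max[of "(u, w)"] that V F_sym unfolding C0_def by auto
    then show ?thesis using sum unfolding k_def by linarith
  qed
  have nb: "F `` {w} \<subseteq> V - {w}" for w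
    using F.arcs_subset F_irr by auto
  have "card A0 = card V - 1 - valency F v"
    unfolding A0_def using nb[of v] V(2) finite_verts by (subst card_Diff_subset) auto
  then have "k - 1 \<le> card A0"
    using sum mk m unfolding k_def by linarith
  then obtain A where A: "A \<subseteq> A0" "card A = k - 1" "finite A"
    by (rule obtain_subset_with_card_n)
  have "C0 \<union> {v} = V - F `` {u}"
    unfolding C0_def using V by auto
  then have card_C: "card (C0 \<union> {v}) = card V - k"
    using nb[of u] finite_verts unfolding k_def by (subst \<open>C0 \<union> {v} = _\<close>, subst card_Diff_subset) auto
  have k2: "2 * k \<le> card V"
    using sum le unfolding k_def by linarith
  have fin: "finite (A \<union> (C0 \<union> {v}))"
    using A(3) finite_verts unfolding C0_def by auto
  have "card V - k \<le> card (A \<union> (C0 \<union> {v}))"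
    using card_mono[OF fin, of "C0 \<union> {v}"] card_C by auto
  moreover have "card A \<le> card V - k"
    using A(2) k2 by linarith
  ultimately obtain D where D: "A \<subseteq> D" "D \<subseteq> A \<union> (C0 \<union> {v})" "card D = card V - k"
    using exists_subset_between[of A "card V - k" "A \<union> (C0 \<union> {v})"] fin by blast
  show thesis
  proof (rule that[OF mk k2 D(1) _ A(2) D(3)])
    show "D \<subseteq> V"
      using D(2) A(1) V unfolding A0_def C0_def by auto
    show "valency E w \<le> k" if "w \<in> A" for w
      using A0_deg[of w] A(1) that le_F[of w] by auto
    show "valency E w \<le> card V - k" if w: "w \<in> D" for w
    proof -
      consider "w \<in> A" | "w \<in> C0 \<union> {v}"
        using D(2) w by blast
      then have "valency F w \<le> card V - k"
      proof cases
        case 1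
        then show ?thesis using A0_deg[of w] A(1) k2 by fastforce
      qed (rule C0_deg)
      then show ?thesis using le_F[of w] by linarith
    qed
  qed
qed

lemma awalk_of_vertex_list:
  assumes "xs \<noteq> []" "successively (\<lambda>v w. (v, w) \<in> parcs G) xs"
  shows "pawalk_verts (hd xs) (zip xs (tl xs)) = xs \<and> pcas (hd xs) (zip xs (tl xs)) (last xs)
    \<and> set (zip xs (tl xs)) \<subseteq> parcs G"
  using assms by (induction xs rule: induct_list012) auto

lemma hamilton_connected_if_ham_conn:
  assumes "ham_conn (pverts G) (parcs G)"
  shows "hamilton_connected G"
  unfolding hamilton_connected_def
proof (intro ballI impI)
  fix u v assume uv: "u \<in> pverts G" "v \<in> pverts G" "u \<noteq> v"
  then obtain xs where "ham_path (pverts G) (parcs G) u xs v"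
    using assms unfolding ham_conn_def by blast
  then have xs: "xs \<noteq> []" "successively (\<lambda>v w. (v, w) \<in> parcs G) xs"
    and ends: "hd xs = u" "last xs = v" and spanning: "distinct xs" "set xs = pverts G"
    unfolding ham_path_def by simp_all
  have "hamilton_path G u (zip xs (tl xs)) v"
    using awalk_of_vertex_list[OF xs] uv(1) spanning unfolding ends
    by (simp add: hamilton_path_def pre_digraph.apath_def pre_digraph.awalk_def
        cas_with_proj_eq awalk_verts_with_proj_eq)
  then show "\<exists>p. hamilton_path G u p v" ..
qed

section \<open>The signless Laplacian as a quadratic form\<close>

text \<open>The action of the matrix \<open>D + A\<close> on a vector indexed by the vertices themselves.\<close>
definition signless_apply :: "'a rel \<Rightarrow> ('a \<Rightarrow> real) \<Rightarrow> 'a \<Rightarrow> real" where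
  "signless_apply E x v = real (valency E v) * x v + (\<Sum>w\<in>E `` {v}. x w)"

text \<open>Every edge is a pair of arcs and is counted twice: the value is twice the quadratic form of \<open>D + A\<close>,
  which is where the factors 2 in front of eigenvalues come from.\<close>
definition arc_form :: "'a rel \<Rightarrow> ('a \<Rightarrow> real) \<Rightarrow> real" where
  "arc_form E x = (\<Sum>(v, w)\<in>E. (x v + x w)\<^sup>2)"

definition sq_norm_on :: "'a set \<Rightarrow> ('a \<Rightarrow> real) \<Rightarrow> real" where
  "sq_norm_on V x = (\<Sum>v\<in>V. (x v)\<^sup>2)"

definition signless_eigen :: "'a set \<Rightarrow> 'a rel \<Rightarrow> real \<Rightarrow> ('a \<Rightarrow> real) \<Rightarrow> bool" where
  "signless_eigen V E q x \<longleftrightarrow> (\<exists>v\<in>V. x v \<noteq> 0) \<and> (\<forall>v\<in>V. signless_apply E x v = q * x v)"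

lemma zero_if_quadratic_nonpos:
  fixes a b :: real
  assumes "\<And>t. a * t + b * t\<^sup>2 \<le> 0"
  shows "a = 0"
proof (rule ccontr)
  assume a: "a \<noteq> 0"
  \<comment> \<open>Any \<open>c > 0\<close> with \<open>b + c > 0\<close> makes the value at \<open>a / c\<close> positive.\<close>
  define c where "c = \<bar>b\<bar> + 1"
  have c: "c > 0" "b + c > 0"
    by (auto simp: c_def)
  have "a * (a / c) + b * (a / c)\<^sup>2 = (a / c)\<^sup>2 * (b + c)"
    using c by (simp add: field_simps power2_eq_square)
  moreover have "(a / c)\<^sup>2 * (b + c) > 0"
    using a c by simp
  ultimately show False
    using assms[of "a / c"] by linarith
qed

lemma sq_norm_on_pos:
  assumes "finite V" "v \<in> V" "x v \<noteq> 0"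
  shows "0 < sq_norm_on V x"
  unfolding sq_norm_on_def using assms by (intro sum_pos2[of V v]) auto

context simple_graph
begin

lemma finite_arcs [simp]: "finite E"
  by (rule finite_subset[OF arcs_subset]) (use finite_verts in simp)

lemma arcs_sym_iff: "(v, w) \<in> E \<longleftrightarrow> (w, v) \<in> E"
  using sym_arcs by (meson symE)

lemma no_loop: "(v, v) \<notin> E"
  using irrefl_arcs by (meson irreflD)

lemma sum_arcs: "(\<Sum>(v, w)\<in>E. f v w) = (\<Sum>v\<in>V. \<Sum>w\<in>E `` {v}. f v w)"
proof -
  have "E = Sigma V (\<lambda>v. E `` {v})"
    using arcs_subset by auto
  then show ?thesis
    using sum.Sigma[of V "\<lambda>v. E `` {v}" f] finite_verts by simp
qed

lemma sum_arcs_swap: "(\<Sum>(v, w)\<in>E. f v w) = (\<Sum>(v, w)\<in>E. f w v)"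
  by (rule sum.reindex_bij_witness[of _ prod.swap prod.swap]) (auto simp: arcs_sym_iff)

text \<open>The polar form of \<open>arc_form\<close>. Symmetry of \<open>D + A\<close>, the value of the form at an eigenvector, and its
  first-order variation are all read off from this identity.\<close>
lemma sum_mult_signless_apply:
  "2 * (\<Sum>v\<in>V. y v * signless_apply E x v) = (\<Sum>(v, w)\<in>E. (y v + y w) * (x v + x w))"
proof -
  have "(\<Sum>(v, w)\<in>E. y v * (x v + x w)) = (\<Sum>v\<in>V. \<Sum>w\<in>E `` {v}. y v * (x v + x w))"
    by (rule sum_arcs)
  also have "\<dots> = (\<Sum>v\<in>V. y v * signless_apply E x v)"
    by (intro sum.cong refl)
      (simp add: signless_apply_def sum.distrib distrib_left flip: sum_distrib_left)
  finally have "(\<Sum>(v, w)\<in>E. y v * (x v + x w)) = (\<Sum>v\<in>V. y v * signless_apply E x v)" .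
  moreover have "(\<Sum>(v, w)\<in>E. (y v + y w) * (x v + x w))
      = (\<Sum>(v, w)\<in>E. y v * (x v + x w)) + (\<Sum>(v, w)\<in>E. y w * (x w + x v))"
    unfolding sum.distrib[symmetric] by (intro sum.cong) (auto simp: algebra_simps)
  ultimately show ?thesis
    using sum_arcs_swap[of "\<lambda>v w. y v * (x v + x w)"] by simp
qed

lemma arc_form_eq: "arc_form E x = 2 * (\<Sum>v\<in>V. x v * signless_apply E x v)"
  unfolding sum_mult_signless_apply arc_form_def by (simp add: power2_eq_square)

lemma signless_apply_symmetric:
  "(\<Sum>v\<in>V. y v * signless_apply E x v) = (\<Sum>v\<in>V. x v * signless_apply E y v)"
  using sum_mult_signless_apply[of y x] sum_mult_signless_apply[of x y] by (simp add: mult.commute)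

lemma arc_form_eigen:
  assumes "signless_eigen V E q x"
  shows "arc_form E x = 2 * q * sq_norm_on V x"
proof -
  have "(\<Sum>v\<in>V. x v * signless_apply E x v) = (\<Sum>v\<in>V. q * (x v)\<^sup>2)"
    using assms by (intro sum.cong) (auto simp: signless_eigen_def power2_eq_square)
  then show ?thesis
    unfolding arc_form_eq sq_norm_on_def sum_distrib_left[symmetric] by simp
qed

text \<open>First-order condition: along the line from \<open>x\<close> in a coordinate direction the difference of both
  sides of the bound is a quadratic polynomial that is nonpositive and vanishes at 0, so its linear
  coefficient, four times the corresponding entry of \<open>(D + A) x - q x\<close>, is 0.\<close>
lemma signless_eigen_if_maximal:
  assumes max: "\<And>y. arc_form E y \<le> 2 * q * sq_norm_on V y"
    and x: "2 * q * sq_norm_on V x \<le> arc_form E x" "\<exists>v\<in>V. x v \<noteq> 0"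
  shows "signless_eigen V E q x"
  unfolding signless_eigen_def
proof (intro conjI ballI)
  fix u assume u: "u \<in> V"
  define h :: "'a \<Rightarrow> real" where "h v = of_bool (v = u)" for v
  have "4 * (signless_apply E x u - q * x u) * t + (arc_form E h - 2 * q) * t\<^sup>2 \<le> 0" for t
  proof -
    have "arc_form E (\<lambda>v. x v + t * h v)
        = arc_form E x + 2 * t * (\<Sum>(v, w)\<in>E. (h v + h w) * (x v + x w)) + t\<^sup>2 * arc_form E h"
      unfolding arc_form_def sum_distrib_left sum.distrib[symmetric]
      by (intro sum.cong) (auto simp: power2_eq_square algebra_simps)
    also have "(\<Sum>(v, w)\<in>E. (h v + h w) * (x v + x w)) = 2 * (\<Sum>v\<in>V. h v * signless_apply E x v)"
      by (rule sum_mult_signless_apply[symmetric])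
    also have "(\<Sum>v\<in>V. h v * signless_apply E x v) = signless_apply E x u"
      using u finite_verts by (simp add: h_def of_bool_def if_distrib[of "\<lambda>c. c * _"] cong: if_cong)
    finally have form: "arc_form E (\<lambda>v. x v + t * h v)
        = arc_form E x + 4 * t * signless_apply E x u + t\<^sup>2 * arc_form E h"
      by simp
    have "sq_norm_on V (\<lambda>v. x v + t * h v)
        = sq_norm_on V x + 2 * t * (\<Sum>v\<in>V. h v * x v) + t\<^sup>2 * (\<Sum>v\<in>V. h v)"
      unfolding sq_norm_on_def sum_distrib_left sum.distrib[symmetric]
      by (intro sum.cong) (auto simp: power2_eq_square algebra_simps h_def)
    also have "(\<Sum>v\<in>V. h v * x v) = x u"
      using u finite_verts by (simp add: h_def of_bool_def if_distrib[of "\<lambda>c. c * _"] cong: if_cong)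
    also have "(\<Sum>v\<in>V. h v) = 1"
      using u finite_verts by (simp add: h_def of_bool_def)
    finally have norm: "sq_norm_on V (\<lambda>v. x v + t * h v) = sq_norm_on V x + 2 * t * x u + t\<^sup>2"
      by simp
    show ?thesis
      using max[of "\<lambda>v. x v + t * h v"] x(1) unfolding form norm by (simp add: algebra_simps)
  qed
  then have "4 * (signless_apply E x u - q * x u) = 0"
    by (rule zero_if_quadratic_nonpos)
  then show "signless_apply E x u = q * x u"
    by simp
qed (use x in blast)

text \<open>The unit sphere of the functions supported on \<open>V\<close> is closed in a product of compact intervals, so
  the continuous form attains its maximum on it. Replacing the entries by their absolute values keeps
  the norm and does not decrease any summand.\<close>
lemma arc_form_maximum:
  assumes "V \<noteq> {}"
  obtains x where "\<And>v. 0 \<le> x v" "sq_norm_on V x = 1"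
    "\<And>y. arc_form E y \<le> arc_form E x * sq_norm_on V y"
proof -
  define S where "S = (\<lambda>v. if v \<in> V then {-1..1::real} else {0})"
  define K where "K = PiE UNIV S \<inter> {x. sq_norm_on V x = 1}"
  have "compactin (product_topology (\<lambda>_. euclidean) UNIV) (PiE UNIV S)"
    unfolding compactin_PiE by (auto simp: S_def)
  then have "compact (PiE UNIV S)"
    by (simp add: euclidean_product_topology)
  moreover have "closed {x. sq_norm_on V x = 1}"
    unfolding sq_norm_on_def by (intro closed_Collect_eq continuous_intros) auto
  ultimately have compact: "compact K"
    unfolding K_def by (rule compact_Int_closed)
  obtain v0 where v0: "v0 \<in> V"
    using assms by blast
  have "(\<lambda>v. of_bool (v = v0)) \<in> K"
    using v0 finite_verts by (auto simp: K_def S_def sq_norm_on_def of_bool_def if_distrib[of "\<lambda>c. c\<^sup>2"] cong: if_cong)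
  then have ne: "K \<noteq> {}"
    by blast
  have cont: "continuous_on K (arc_form E)"
    unfolding arc_form_def case_prod_beta
    by (intro continuous_intros continuous_on_subset[OF continuous_on_product_coordinates]) auto
  obtain x0 where x0: "x0 \<in> K" and max0: "\<And>y. y \<in> K \<Longrightarrow> arc_form E y \<le> arc_form E x0"
    using continuous_attains_sup[OF compact ne cont] by blast
  define x where "x = (\<lambda>v. \<bar>x0 v\<bar>)"
  have norm: "sq_norm_on V x = 1"
    using x0 by (simp add: K_def sq_norm_on_def x_def)
  have "arc_form E x0 \<le> arc_form E x"
    unfolding arc_form_def x_def
    by (intro sum_mono) (auto simp flip: abs_le_square_iff)
  with max0 have max: "arc_form E y \<le> arc_form E x" if "y \<in> K" for y
    using that by fastforce
  show thesis
  proof (rule that[of x])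
    fix y
    show "arc_form E y \<le> arc_form E x * sq_norm_on V y"
    proof (cases "\<exists>v\<in>V. y v \<noteq> 0")
      case True
      then have pos: "sq_norm_on V y > 0"
        using sq_norm_on_pos finite_verts by metis
      define s where "s = sqrt (sq_norm_on V y)"
      have s: "s > 0" "s\<^sup>2 = sq_norm_on V y"
        using pos by (auto simp: s_def)
      define z where "z = (\<lambda>v. if v \<in> V then y v / s else 0)"
      have "sq_norm_on V z = sq_norm_on V y / s\<^sup>2"
        unfolding sq_norm_on_def sum_divide_distrib by (intro sum.cong) (auto simp: z_def power_divide)
      then have z1: "sq_norm_on V z = 1"
        using s(2) pos by simp
      have "-1 \<le> z v \<and> z v \<le> 1" if "v \<in> V" for v
      proof -
        have "(z v)\<^sup>2 \<le> sq_norm_on V z"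
          unfolding sq_norm_on_def using that finite_verts by (intro member_le_sum) auto
        then show ?thesis
          using z1 by (simp add: abs_square_le_1 abs_le_iff)
      qed
      moreover have "z v = 0" if "v \<notin> V" for v
        using that by (simp add: z_def)
      ultimately have "z \<in> K"
        using z1 by (auto simp: K_def S_def)
      moreover have "arc_form E z = arc_form E y / s\<^sup>2"
        unfolding arc_form_def sum_divide_distrib
        using arcs_subset by (intro sum.cong) (auto simp: z_def power_divide simp flip: add_divide_distrib)
      ultimately show ?thesis
        using mult_right_mono[OF max[of z], of "sq_norm_on V y"] s(2) pos by simp
    next
      case False
      then have "arc_form E y = 0" "sq_norm_on V y = 0"
        using arcs_subset unfolding arc_form_def sq_norm_on_def by (auto intro!: sum.neutral)
      then show ?thesis by simp
    qed
  qed (use norm in \<open>auto simp: x_def\<close>)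
qed

lemma ex_perron_vector:
  assumes "V \<noteq> {}"
  obtains q x where "\<And>v. 0 \<le> x v" "signless_eigen V E q x"
    "\<And>y. arc_form E y \<le> 2 * q * sq_norm_on V y"
proof -
  obtain x where x: "\<And>v. 0 \<le> x v" "sq_norm_on V x = 1"
    "\<And>y. arc_form E y \<le> arc_form E x * sq_norm_on V y"
    using arc_form_maximum[OF assms] by blast
  have "\<exists>v\<in>V. x v \<noteq> 0"
    using x(2) by (auto simp: sq_norm_on_def intro: ccontr)
  then have "signless_eigen V E (arc_form E x / 2) x"
    using x by (intro signless_eigen_if_maximal) auto
  then show thesis
    using that[of x "arc_form E x / 2"] x by auto
qed

text \<open>The upper bound of Collatz and Wielandt, by pairing the eigenvector with \<open>y\<close> and using the symmetry of
  \<open>D + A\<close>.\<close>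
lemma signless_eigen_le:
  assumes x: "signless_eigen V E q x" "\<And>v. v \<in> V \<Longrightarrow> 0 \<le> x v"
    and y: "\<And>v. v \<in> V \<Longrightarrow> 0 < y v" "\<And>v. v \<in> V \<Longrightarrow> signless_apply E y v \<le> c * y v"
  shows "q \<le> c"
proof -
  have "q * (\<Sum>v\<in>V. y v * x v) = (\<Sum>v\<in>V. y v * signless_apply E x v)"
    unfolding sum_distrib_left using x(1) by (intro sum.cong) (auto simp: signless_eigen_def)
  also have "\<dots> = (\<Sum>v\<in>V. x v * signless_apply E y v)"
    by (rule signless_apply_symmetric)
  also have "\<dots> \<le> (\<Sum>v\<in>V. x v * (c * y v))"
    using x(2) y(2) by (intro sum_mono mult_left_mono) auto
  also have "\<dots> = c * (\<Sum>v\<in>V. y v * x v)"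
    unfolding sum_distrib_left by (intro sum.cong) (auto simp: algebra_simps)
  finally have "q * (\<Sum>v\<in>V. y v * x v) \<le> c * (\<Sum>v\<in>V. y v * x v)" .
  moreover have "0 < (\<Sum>v\<in>V. y v * x v)"
  proof -
    obtain v where "v \<in> V" "x v \<noteq> 0"
      using x(1) unfolding signless_eigen_def by blast
    moreover from this have "0 < x v"
      using x(2)[of v] by simp
    ultimately show ?thesis
      using x(2) y(1) finite_verts by (intro sum_pos2[of V v]) (auto simp: less_imp_le)
  qed
  ultimately show ?thesis
    by simp
qed

text \<open>Contributions from the arcs outside \<open>P\<close>, between \<open>P\<close> and its complement, and inside \<open>P\<close>. The
  middle term is doubled since it lists each edge from its end in \<open>P\<close> only.\<close>
lemma arc_form_split:
  assumes "P \<subseteq> V"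
  shows "arc_form E x = (\<Sum>(v, w)\<in>E \<inter> (V - P) \<times> (V - P). (x v + x w)\<^sup>2)
    + 2 * (\<Sum>p\<in>P. \<Sum>w\<in>E `` {p} - P. (x p + x w)\<^sup>2)
    + (\<Sum>(v, w)\<in>E \<inter> P \<times> P. (x v + x w)\<^sup>2)"
proof -
  let ?I = "V - P"
  let ?g = "\<lambda>(v, w). (x v + x w)\<^sup>2"
  have fin: "finite P" "finite ?I"
    using assms finite_verts finite_subset by auto
  have cross: "sum ?g (E \<inter> P \<times> ?I) = (\<Sum>p\<in>P. \<Sum>w\<in>E `` {p} - P. (x p + x w)\<^sup>2)"
  proof -
    have "E \<inter> P \<times> ?I = Sigma P (\<lambda>p. E `` {p} - P)"
      using arcs_subset by auto
    then show ?thesis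
      using fin by (simp add: sum.Sigma)
  qed
  have cross': "sum ?g (E \<inter> ?I \<times> P) = sum ?g (E \<inter> P \<times> ?I)"
    by (rule sum.reindex_bij_witness[of _ prod.swap prod.swap])
      (auto simp: arcs_sym_iff add.commute)
  have "E = (E \<inter> ?I \<times> ?I) \<union> (E \<inter> ?I \<times> P) \<union> (E \<inter> P \<times> ?I) \<union> (E \<inter> P \<times> P)"
    using arcs_subset by auto
  then have "arc_form E x = sum ?g ((E \<inter> ?I \<times> ?I) \<union> (E \<inter> ?I \<times> P) \<union> (E \<inter> P \<times> ?I) \<union> (E \<inter> P \<times> P))"
    unfolding arc_form_def by simp
  also have "\<dots> = sum ?g (E \<inter> ?I \<times> ?I) + sum ?g (E \<inter> ?I \<times> P) + sum ?g (E \<inter> P \<times> ?I) + sum ?g (E \<inter> P \<times> P)"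
    by (subst sum.union_disjoint; (subst sum.union_disjoint)?; (subst sum.union_disjoint)?) auto
  finally show ?thesis
    using cross cross' by simp
qed

text \<open>A zero entry of a nonnegative eigenvector forces zeros at all neighbours, and every vertex is
  adjacent to \<open>k\<close>.\<close>
lemma signless_eigen_pos:
  assumes x: "signless_eigen V E q x" "\<And>v. v \<in> V \<Longrightarrow> 0 \<le> x v"
    and k: "k \<in> V" "\<And>v. v \<in> V \<Longrightarrow> v \<noteq> k \<Longrightarrow> (k, v) \<in> E"
    and v: "v \<in> V"
  shows "0 < x v"
proof -
  have eq: "signless_apply E x v = q * x v" if "v \<in> V" for v
    using x(1) that by (auto simp: signless_eigen_def)
  have nonneg: "0 \<le> x w" if "w \<in> E `` {v}" for v w
    using x(2) that arcs_subset by auto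
  have spread: "0 < x v" if "v \<in> V" "(v, w) \<in> E" "0 < x w" for v w
  proof (rule ccontr)
    assume "\<not> 0 < x v"
    then have "x v = 0"
      using x(2)[OF that(1)] by simp
    then have "(\<Sum>w\<in>E `` {v}. x w) = 0"
      using eq[OF that(1)] by (simp add: signless_apply_def)
    then have "x w = 0"
      using that(2) nonneg[of _ v] by (subst (asm) sum_nonneg_eq_0_iff) auto
    then show False
      using that(3) by simp
  qed
  obtain v0 where v0: "v0 \<in> V" "0 < x v0"
    using x unfolding signless_eigen_def by (metis less_le)
  have "0 < x k"
    using spread[OF k(1) k(2)[OF v0(1)] v0(2)] v0 by (cases "v0 = k") auto
  then show ?thesis
    using spread[OF v _ \<open>0 < x k\<close>] k(2)[OF v] arcs_sym_iff by (cases "v = k") auto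
qed

end

lemma out_degree_with_proj: "out_degree (with_proj G) v = valency (parcs G) v"
proof -
  have "out_arcs (with_proj G) v = Pair v ` (parcs G `` {v})"
    by (auto simp: out_arcs_def)
  then show ?thesis
    unfolding out_degree_def by (simp add: card_image inj_on_def)
qed

lemma simple_graph_pair_graph:
  assumes "pair_graph G"
  shows "simple_graph (pverts G) (parcs G)"
proof -
  interpret pair_graph G by fact
  show ?thesis
  proof
    show "finite (pverts G)" by (rule pair_finite_verts)
    show "parcs G \<subseteq> pverts G \<times> pverts G"
      using wellformed' by auto
    show "sym (parcs G)"
      using pair_sym_arcs by (simp add: symmetric_def)
    show "irrefl (parcs G)"
      using pair_no_loops by (force simp: irrefl_def)
  qed
qed

lemma signless_laplacian_mult_vec:
  assumes "finite (pverts G)" "parcs G \<subseteq> pverts G \<times> pverts G"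
  shows "signless_laplacian G *\<^sub>v vec (card (pverts G)) (\<lambda>i. x (from_nat_into (pverts G) i))
    = vec (card (pverts G)) (\<lambda>i. signless_apply (parcs G) x (from_nat_into (pverts G) i))"
proof (rule eq_vecI)
  let ?V = "pverts G" and ?E = "parcs G"
  let ?n = "card ?V" and ?f = "from_nat_into ?V"
  fix i assume "i < dim_vec (vec ?n (\<lambda>i. signless_apply ?E x (?f i)))"
  then have i: "i < ?n" by simp
  have bij: "bij_betw ?f {..<?n} ?V"
    by (rule bij_betw_from_nat_into_finite[OF assms(1)])
  have "(signless_laplacian G *\<^sub>v vec ?n (\<lambda>i. x (?f i))) $ i
      = (\<Sum>j<?n. ((if i = j then real (out_degree (with_proj G) (?f j)) else 0)
        + (if (?f i, ?f j) \<in> ?E then 1 else 0)) * x (?f j))"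
    using i unfolding signless_laplacian_def degree_mat_def adjacency_mat_def mat_diag_def
    by (auto simp: scalar_prod_def atLeast0LessThan intro!: sum.cong)
  also have "\<dots> = (\<Sum>j<?n. (if i = j then real (valency ?E (?f j)) * x (?f j) else 0)
        + (if (?f i, ?f j) \<in> ?E then x (?f j) else 0))"
    by (intro sum.cong) (auto simp: out_degree_with_proj distrib_right)
  also have "\<dots> = real (valency ?E (?f i)) * x (?f i) + (\<Sum>j<?n. if (?f i, ?f j) \<in> ?E then x (?f j) else 0)"
    using i by (simp add: sum.distrib)
  also have "(\<Sum>j<?n. if (?f i, ?f j) \<in> ?E then x (?f j) else 0) = (\<Sum>w\<in>?V. if (?f i, w) \<in> ?E then x w else 0)"
    by (rule sum.reindex_bij_betw[OF bij])
  also have "\<dots> = (\<Sum>w\<in>{w \<in> ?V. (?f i, w) \<in> ?E}. x w)"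
    using assms(1) by (simp add: sum.If_cases Int_def)
  also have "{w \<in> ?V. (?f i, w) \<in> ?E} = ?E `` {?f i}"
    using assms(2) by auto
  finally show "(signless_laplacian G *\<^sub>v vec ?n (\<lambda>i. x (?f i))) $ i
      = vec ?n (\<lambda>i. signless_apply ?E x (?f i)) $ i"
    using i by (simp add: signless_apply_def)
qed (simp add: signless_laplacian_def degree_mat_def adjacency_mat_def)

lemma eigenvalue_signless_laplacian_iff:
  assumes "finite (pverts G)" "parcs G \<subseteq> pverts G \<times> pverts G"
  shows "eigenvalue (signless_laplacian G) q \<longleftrightarrow> (\<exists>x. signless_eigen (pverts G) (parcs G) q x)"
proof -
  let ?V = "pverts G" and ?E = "parcs G" and ?M = "signless_laplacian G"
  let ?n = "card ?V" and ?f = "from_nat_into ?V"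
  let ?vec = "\<lambda>x. vec ?n (\<lambda>i. x (?f i))"
  have bij: "bij_betw ?f {..<?n} ?V"
    by (rule bij_betw_from_nat_into_finite[OF assms(1)])
  have dim: "dim_row ?M = ?n"
    by (simp add: signless_laplacian_def degree_mat_def adjacency_mat_def)
  have onto: "(\<forall>i<?n. P (?f i)) \<longleftrightarrow> (\<forall>v\<in>?V. P v)" for P
    using bij by (metis bij_betw_imp_surj_on image_iff lessThan_iff)
  have "eigenvector ?M (?vec x) q \<longleftrightarrow> signless_eigen ?V ?E q x" for x
  proof -
    have "?vec x = 0\<^sub>v ?n \<longleftrightarrow> (\<forall>v\<in>?V. x v = 0)"
      unfolding onto[symmetric] by (auto simp: vec_eq_iff)
    moreover have "?M *\<^sub>v ?vec x = q \<cdot>\<^sub>v ?vec x \<longleftrightarrow> (\<forall>v\<in>?V. signless_apply ?E x v = q * x v)"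
      unfolding signless_laplacian_mult_vec[OF assms] onto[symmetric] by (auto simp: vec_eq_iff)
    ultimately show ?thesis
      unfolding eigenvector_def signless_eigen_def dim by auto
  qed
  moreover have "\<exists>x. w = ?vec x" if "w \<in> carrier_vec ?n" for w :: "real vec"
  proof
    have "the_inv_into {..<?n} ?f (?f i) = i" if "i < ?n" for i
      using bij that by (intro the_inv_into_f_f) (auto simp: bij_betw_def)
    then show "w = ?vec (\<lambda>v. w $ the_inv_into {..<?n} ?f v)"
      using that by (intro eq_vecI) auto
  qed
  ultimately show ?thesis
    unfolding eigenvalue_def by (metis dim eigenvector_def)
qed

text \<open>The link between the matrix definition and the quadratic form: the maximum of the form is an
  eigenvalue, and no eigenvalue exceeds it.\<close>
theorem signless_laplacian_radius_properties:
  assumes "pair_graph G" "pverts G \<noteq> {}"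
  shows "\<exists>x. (\<forall>v. 0 \<le> x v) \<and> signless_eigen (pverts G) (parcs G) (signless_laplacian_radius G) x"
    and "arc_form (parcs G) y \<le> 2 * signless_laplacian_radius G * sq_norm_on (pverts G) y"
proof -
  interpret simple_graph "pverts G" "parcs G"
    using assms(1) by (rule simple_graph_pair_graph)
  obtain q x where x: "\<And>v. 0 \<le> x v" "signless_eigen (pverts G) (parcs G) q x"
    and max: "\<And>y. arc_form (parcs G) y \<le> 2 * q * sq_norm_on (pverts G) y"
    using ex_perron_vector[OF assms(2)] by metis
  have spec: "spectrum (signless_laplacian G) = {c. \<exists>x. signless_eigen (pverts G) (parcs G) c x}"
    unfolding spectrum_def using eigenvalue_signless_laplacian_iff[OF finite_verts arcs_subset] by auto
  have "signless_laplacian G \<in> carrier_mat (card (pverts G)) (card (pverts G))"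
    by (simp add: signless_laplacian_def degree_mat_def adjacency_mat_def)
  then have "finite (spectrum (signless_laplacian G))"
    by (rule card_finite_spectrum(1))
  moreover have "c \<le> q" if c: "c \<in> spectrum (signless_laplacian G)" for c
  proof -
    obtain z where z: "signless_eigen (pverts G) (parcs G) c z"
      using c unfolding spec by blast
    then have "0 < sq_norm_on (pverts G) z"
      using sq_norm_on_pos[OF finite_verts] unfolding signless_eigen_def by metis
    then show ?thesis
      using max[of z] arc_form_eigen[OF z] by simp
  qed
  moreover have "q \<in> spectrum (signless_laplacian G)"
    using x spec by auto
  ultimately have "signless_laplacian_radius G = q"
    unfolding signless_laplacian_radius_def by (intro Max_eqI) auto
  then show "\<exists>x. (\<forall>v. 0 \<le> x v) \<and> signless_eigen (pverts G) (parcs G) (signless_laplacian_radius G) x"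
    and "arc_form (parcs G) y \<le> 2 * signless_laplacian_radius G * sq_norm_on (pverts G) y"
    using x max by auto
qed

section \<open>The extremal graph\<close>

text \<open>The arcs of the join of the complete graph on \<open>K\<close> with the disjoint union of the complete graph on the
  vertices outside \<open>K\<close> and \<open>P\<close> and the edgeless graph on \<open>P\<close>. For \<open>|K| = 3\<close> and \<open>|P| = 2\<close> this is
  \<open>S\<^sub>n\<^sup>3\<close> on an arbitrary vertex set.\<close>
definition join_arcs :: "'a set \<Rightarrow> 'a set \<Rightarrow> 'a set \<Rightarrow> 'a rel" where
  "join_arcs V K P = {(v, w). v \<in> V \<and> w \<in> V \<and> v \<noteq> w \<and> (v \<in> P \<longrightarrow> w \<in> K) \<and> (w \<in> P \<longrightarrow> v \<in> K)}"

lemma simple_graph_join_arcs: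
  assumes "finite V"
  shows "simple_graph V (join_arcs V K P)"
  using assms by unfold_locales (auto simp: join_arcs_def sym_def irrefl_def)

lemma arc_form_join_arcs:
  assumes "finite V" "P \<subseteq> V" "K \<subseteq> V" "K \<inter> P = {}"
  shows "arc_form (join_arcs V K P) x = (\<Sum>(v, w)\<in>(V - P) \<times> (V - P) - Id. (x v + x w)\<^sup>2)
    + 2 * (\<Sum>p\<in>P. \<Sum>w\<in>K. (x p + x w)\<^sup>2)"
proof -
  interpret simple_graph V "join_arcs V K P"
    by (rule simple_graph_join_arcs[OF assms(1)])
  have "join_arcs V K P `` {p} - P = K" if "p \<in> P" for p
    using that assms by (auto simp: join_arcs_def)
  moreover have "join_arcs V K P \<inter> (V - P) \<times> (V - P) = (V - P) \<times> (V - P) - Id"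
    "join_arcs V K P \<inter> P \<times> P = {}"
    using assms by (auto simp: join_arcs_def)
  ultimately show ?thesis
    unfolding arc_form_split[OF assms(2)] by simp
qed

lemma join_arcs_image:
  assumes "bij_betw f V V'" "K \<subseteq> V" "P \<subseteq> V"
  shows "map_prod f f ` join_arcs V K P = join_arcs V' (f ` K) (f ` P)"
proof -
  have inj: "f v = f w \<longleftrightarrow> v = w" if "v \<in> V" "w \<in> V" for v w
    using assms(1) that by (auto simp: bij_betw_def inj_on_eq_iff)
  have mem: "f v \<in> f ` W \<longleftrightarrow> v \<in> W" if "v \<in> V" "W \<subseteq> V" for v W
    using that inj by (metis image_iff subsetD)
  have V': "V' = f ` V"
    using assms(1) by (simp add: bij_betw_def)
  have "(f v, f w) \<in> join_arcs V' (f ` K) (f ` P) \<longleftrightarrow> (v, w) \<in> join_arcs V K P" if "v \<in> V" "w \<in> V" for v w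
    using that assms(2,3) by (simp add: join_arcs_def V' inj mem)
  then show ?thesis
    unfolding set_eq_iff by (auto simp: V' join_arcs_def; blast)
qed

lemma arc_form_bij:
  assumes "bij_betw f V V'" "E \<subseteq> V \<times> V" "map_prod f f ` E = E'"
  shows "arc_form E' x = arc_form E (x \<circ> f)" "sq_norm_on V' x = sq_norm_on V (x \<circ> f)"
proof -
  have "inj_on f V"
    using assms(1) by (simp add: bij_betw_def)
  then have "inj_on (map_prod f f) (V \<times> V)"
    by (simp add: map_prod_inj_on)
  then have "inj_on (map_prod f f) E"
    using assms(2) by (rule inj_on_subset)
  then have "arc_form E' x = (\<Sum>p\<in>E. case map_prod f f p of (v, w) \<Rightarrow> (x v + x w)\<^sup>2)"
    unfolding arc_form_def assms(3)[symmetric] by (simp add: sum.reindex)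
  then show "arc_form E' x = arc_form E (x \<circ> f)"
    unfolding arc_form_def by (simp add: case_prod_beta)
  show "sq_norm_on V' x = sq_norm_on V (x \<circ> f)"
    unfolding sq_norm_on_def using sum.reindex_bij_betw[OF assms(1), of "\<lambda>v. (x v)\<^sup>2"] by simp
qed

abbreviation S3_core :: "(nat + nat + nat \<times> nat) set" where
  "S3_core \<equiv> Inl ` {..<3}"

abbreviation S3_outer :: "(nat + nat + nat \<times> nat) set" where
  "S3_outer \<equiv> Inr ` Inr ` ({..<2} \<times> {0})"

lemma pverts_S3: "pverts (S3 n) = S3_core \<union> Inr ` Inl ` {..<n - 5} \<union> S3_outer"
  by (auto simp: S3_def graph_join_def disjoint_union_def complete_graph_def copies_def Plus_def)

lemma parcs_S3: "parcs (S3 n) = join_arcs (pverts (S3 n)) S3_core S3_outer"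
  unfolding pverts_S3
  by (auto simp: join_arcs_def S3_def graph_join_def disjoint_union_def complete_graph_def copies_def Plus_def)

lemma finite_pverts_S3 [simp]: "finite (pverts (S3 n))"
  unfolding pverts_S3 by simp

lemma pverts_S3_nonempty: "pverts (S3 n) \<noteq> {}"
  unfolding pverts_S3 by (auto simp: lessThan_empty_iff)

lemma pair_graph_S3: "pair_graph (S3 n)"
proof -
  interpret simple_graph "pverts (S3 n)" "parcs (S3 n)"
    unfolding parcs_S3 by (rule simple_graph_join_arcs) simp
  show ?thesis
  proof
    show "finite (pverts (S3 n))" "finite (parcs (S3 n))"
      by simp_all
    show "symmetric (with_proj (S3 n))"
      using sym_arcs by (simp add: symmetric_def)
  qed (use arcs_subset no_loop in auto)
qed

lemma card_pverts_S3:
  assumes "5 \<le> n"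
  shows "card (pverts (S3 n)) = n"
proof -
  have "card (pverts (S3 n)) = card S3_core + card (Inr ` Inl ` {..<n - 5} :: (nat + nat + nat \<times> nat) set) + card S3_outer"
    unfolding pverts_S3 by (subst card_Un_disjoint; (subst card_Un_disjoint)?) auto
  then show ?thesis
    using assms by (simp add: card_image inj_on_def)
qed

text \<open>Only the sizes of the three parts matter, so every copy of \<open>S\<^sub>n\<^sup>3\<close> can be compared with the concrete one.\<close>
lemma ex_bij_S3:
  assumes V: "finite V" "card V = n" "5 \<le> n"
    and K: "K \<subseteq> V" "card K = 3" and P: "P \<subseteq> V" "card P = 2" "K \<inter> P = {}"
  obtains f where "bij_betw f (pverts (S3 n)) V" "f ` S3_core = K" "f ` S3_outer = P"
proof -
  let ?R = "Inr ` Inl ` {..<n - 5} :: (nat + nat + nat \<times> nat) set"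
  have fin: "finite K" "finite P"
    using V K P finite_subset by blast+
  have "card (V - (K \<union> P)) = n - 5"
    using V K P fin by (subst card_Diff_subset) (auto simp: card_Un_disjoint)
  then obtain f1 f2 f3 where f: "bij_betw f1 S3_core K" "bij_betw f2 S3_outer P" "bij_betw f3 ?R (V - (K \<union> P))"
    using finite_same_card_bij[of S3_core K] finite_same_card_bij[of S3_outer P]
      finite_same_card_bij[of ?R "V - (K \<union> P)"] fin V K P
    by (auto simp: card_image inj_on_def)
  define f where "f v = (if v \<in> S3_core then f1 v else if v \<in> S3_outer then f2 v else f3 v)" for v
  have 1: "bij_betw f S3_core K"
    using f(1) by (rule bij_betw_cong[THEN iffD1, rotated]) (auto simp: f_def)
  have 2: "bij_betw f S3_outer P"
    using f(2) by (rule bij_betw_cong[THEN iffD1, rotated]) (auto simp: f_def)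
  have 3: "bij_betw f ?R (V - (K \<union> P))"
    using f(3) by (rule bij_betw_cong[THEN iffD1, rotated]) (auto simp: f_def)
  have "bij_betw f (S3_core \<union> ?R \<union> S3_outer) (K \<union> (V - (K \<union> P)) \<union> P)"
    using P(3) by (intro bij_betw_combine 1 2 3) auto
  moreover have "K \<union> (V - (K \<union> P)) \<union> P = V"
    using K P by auto
  ultimately show thesis
    using that[of f] 1 2 unfolding pverts_S3 by (simp add: bij_betw_def)
qed

lemma S3_core_outer_subset: "S3_core \<subseteq> pverts (S3 n)" "S3_outer \<subseteq> pverts (S3 n)"
  unfolding pverts_S3 by auto

text \<open>The Rayleigh bound for a copy of \<open>S\<^sub>n\<^sup>3\<close>. A nonnegative nonzero vector attaining it is an eigenvector and
  therefore positive, because the vertices of the core are adjacent to all others.\<close>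
lemma arc_form_join_le_radius_S3:
  assumes V: "finite V" "card V = n" "5 \<le> n"
    and K: "K \<subseteq> V" "card K = 3" and P: "P \<subseteq> V" "card P = 2" "K \<inter> P = {}"
  shows "arc_form (join_arcs V K P) x \<le> 2 * signless_laplacian_radius (S3 n) * sq_norm_on V x"
    and "2 * signless_laplacian_radius (S3 n) * sq_norm_on V x \<le> arc_form (join_arcs V K P) x
      \<Longrightarrow> (\<And>v. 0 \<le> x v) \<Longrightarrow> \<exists>v\<in>V. x v \<noteq> 0 \<Longrightarrow> v \<in> V \<Longrightarrow> 0 < x v"
proof -
  let ?q = "signless_laplacian_radius (S3 n)"
  obtain f where f: "bij_betw f (pverts (S3 n)) V" "f ` S3_core = K" "f ` S3_outer = P"
    using ex_bij_S3[OF assms] by blast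
  interpret S: simple_graph "pverts (S3 n)" "parcs (S3 n)"
    using pair_graph_S3 by (rule simple_graph_pair_graph)
  have img: "map_prod f f ` parcs (S3 n) = join_arcs V K P"
    unfolding parcs_S3 using join_arcs_image[OF f(1) S3_core_outer_subset] f by simp
  note tr = arc_form_bij[OF f(1) S.arcs_subset img]
  have max: "arc_form (parcs (S3 n)) y \<le> 2 * ?q * sq_norm_on (pverts (S3 n)) y" for y
    by (rule signless_laplacian_radius_properties(2)[OF pair_graph_S3 pverts_S3_nonempty])
  show "arc_form (join_arcs V K P) x \<le> 2 * ?q * sq_norm_on V x"
    unfolding tr by (rule max)
  assume x: "2 * ?q * sq_norm_on V x \<le> arc_form (join_arcs V K P) x" "\<And>v. 0 \<le> x v"
    "\<exists>v\<in>V. x v \<noteq> 0" "v \<in> V"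
  have V_img: "V = f ` pverts (S3 n)"
    using f(1) by (simp add: bij_betw_def)
  have eigen: "signless_eigen (pverts (S3 n)) (parcs (S3 n)) ?q (x \<circ> f)"
  proof (rule S.signless_eigen_if_maximal[OF max])
    show "2 * ?q * sq_norm_on (pverts (S3 n)) (x \<circ> f) \<le> arc_form (parcs (S3 n)) (x \<circ> f)"
      using x(1) unfolding tr .
    show "\<exists>w\<in>pverts (S3 n). (x \<circ> f) w \<noteq> 0"
      using x(3) V_img by auto
  qed
  obtain w where w: "w \<in> pverts (S3 n)" "v = f w"
    using x(4) V_img by auto
  have "0 < (x \<circ> f) w"
    by (rule S.signless_eigen_pos[OF eigen _ _ _ w(1), where k = "Inl 0"])
      (use x(2) in \<open>auto simp: parcs_S3 join_arcs_def pverts_S3\<close>)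
  then show "0 < x v"
    using w by simp
qed

text \<open>The test vector is the indicator of the clique \<open>K\<^bsub>n-2\<^esub>\<close>: each edge of the clique contributes 4 and each
  of the six edges to the two outer vertices contributes 1.\<close>
lemma radius_S3_ge:
  assumes "5 \<le> n"
  shows "2 * real n - 6 + 6 / (real n - 2) \<le> signless_laplacian_radius (S3 n)"
proof -
  let ?q = "signless_laplacian_radius (S3 n)"
  let ?V = "pverts (S3 n)" and ?I = "pverts (S3 n) - S3_outer"
  define x :: "nat + nat + nat \<times> nat \<Rightarrow> real" where "x v = of_bool (v \<notin> S3_outer)" for v
  have disj: "S3_core \<inter> S3_outer = {}"
    by auto
  have card_outer: "card S3_outer = 2"
    by (simp add: card_image inj_on_def)
  have card_I: "card ?I = n - 2"
    using card_pverts_S3[OF assms] S3_core_outer_subset card_outer by (subst card_Diff_subset) auto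
  have "card (?I \<times> ?I - Id) = card (?I \<times> ?I) - card (Id_on ?I)"
    by (subst card_Diff_subset[symmetric]) (auto intro!: arg_cong[where f = card] finite_subset[of "Id_on ?I" "?I \<times> ?I"])
  also have "card (Id_on ?I) = card ?I"
    by (rule bij_betw_same_card[of fst]) (force simp: bij_betw_def inj_on_def)
  finally have "card (?I \<times> ?I - Id) = (n - 2) * (n - 2) - (n - 2)"
    using card_I by (simp add: card_cartesian_product)
  also have "\<dots> = (n - 2) * (n - 3)"
    by (simp add: diff_mult_distrib2[of "n - 2" "n - 2" 1, simplified, symmetric])
  finally have card_pairs: "real (card (?I \<times> ?I - Id)) = (real n - 2) * (real n - 3)"
    using assms by (simp add: of_nat_diff)
  have "arc_form (parcs (S3 n)) x = (\<Sum>(v, w)\<in>?I \<times> ?I - Id. (x v + x w)\<^sup>2)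
      + 2 * (\<Sum>p\<in>S3_outer. \<Sum>w\<in>S3_core. (x p + x w)\<^sup>2)"
    unfolding parcs_S3 by (rule arc_form_join_arcs) (use S3_core_outer_subset disj in auto)
  also have "(\<Sum>(v, w)\<in>?I \<times> ?I - Id. (x v + x w)\<^sup>2) = (\<Sum>p\<in>?I \<times> ?I - Id. 4)"
    by (intro sum.cong) (auto simp: x_def)
  also have "(\<Sum>p\<in>S3_outer. \<Sum>w\<in>S3_core. (x p + x w)\<^sup>2) = (\<Sum>p\<in>S3_outer. \<Sum>w\<in>S3_core. 1)"
    by (intro sum.cong) (auto simp: x_def)
  finally have form: "arc_form (parcs (S3 n)) x = 4 * ((real n - 2) * (real n - 3)) + 12"
    using card_pairs card_outer by (simp add: card_image)
  have "sq_norm_on ?V x = (\<Sum>v\<in>?V. if v \<in> S3_outer then 0 else 1)"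
    unfolding sq_norm_on_def by (intro sum.cong) (auto simp: x_def)
  also have "\<dots> = real (card ?I)"
    by (simp add: sum.If_cases Diff_eq)
  finally have norm: "sq_norm_on ?V x = real n - 2"
    using card_I assms by (simp add: of_nat_diff)
  have "arc_form (parcs (S3 n)) x \<le> 2 * ?q * sq_norm_on ?V x"
    by (rule signless_laplacian_radius_properties(2)[OF pair_graph_S3 pverts_S3_nonempty])
  then show ?thesis
    using assms unfolding form norm by (simp add: field_simps)
qed

lemma digraph_iso_S3:
  assumes G: "pair_graph G" "parcs G = join_arcs (pverts G) K P"
    and n: "card (pverts G) = n" "5 \<le> n"
    and K: "K \<subseteq> pverts G" "card K = 3" and P: "P \<subseteq> pverts G" "card P = 2" "K \<inter> P = {}"
  shows "digraph_iso (with_proj G) (with_proj (S3 n))"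
proof -
  interpret pair_graph G by fact
  obtain f where f: "bij_betw f (pverts (S3 n)) (pverts G)" "f ` S3_core = K" "f ` S3_outer = P"
    using ex_bij_S3[OF pair_finite_verts n K P] by blast
  define g where "g = the_inv_into (pverts (S3 n)) f"
  have g: "bij_betw g (pverts G) (pverts (S3 n))"
    unfolding g_def using f(1) by (rule bij_betw_the_inv_into)
  have gf: "g (f v) = v" if "v \<in> pverts (S3 n)" for v
    unfolding g_def using f(1) that by (auto simp: bij_betw_def the_inv_into_f_f)
  have "g ` f ` W = W" if "W \<subseteq> pverts (S3 n)" for W
    using that gf by (force simp: image_image)
  then have "g ` K = S3_core" "g ` P = S3_outer"
    using S3_core_outer_subset f by metis+
  then have arcs: "map_prod g g ` parcs G = parcs (S3 n)"
    unfolding parcs_S3 G(2) using join_arcs_image[OF g K(1) P(1)] by simp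
  define h where "h = \<lparr>iso_verts = g, iso_arcs = map_prod g g, iso_head = snd, iso_tail = fst\<rparr>"
  have inj: "inj_on g (pverts G)"
    using g by (simp add: bij_betw_def)
  then have "inj_on (map_prod g g) (parcs G)"
    using wellformed' by (auto simp: inj_on_def)
  then have "pre_digraph.digraph_isomorphism (with_proj G) h"
    unfolding pre_digraph.digraph_isomorphism_def h_def using inj wf_digraph_axioms by auto
  moreover have "with_proj (S3 n) = app_iso h (with_proj G)"
    unfolding app_iso_def with_proj_def h_def using arcs g by (simp add: bij_betw_def)
  ultimately show ?thesis
    unfolding digraph_iso_def by blast
qed

section \<open>Upper bounds from vertex degrees\<close>

context simple_graph
begin

text \<open>The Collatz-Wielandt bound with the degrees as weights. For a vertex of degree \<open>d\<close> the neighbours'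
  degrees sum to at most \<open>d (n - 1)\<close>, which suffices for \<open>d \<le> n - 5\<close>. For larger \<open>d\<close> they sum to at most
  the total degree sum minus \<open>d\<close> and minus 3 for every non-neighbour; the resulting bound is sharp at
  \<open>d = n - 1\<close>, and this is what determines the number \<open>2n - 6 + 6/(n - 1)\<close>.\<close>
lemma radius_le_if_few_edges:
  assumes x: "signless_eigen V E q x" "\<And>v. v \<in> V \<Longrightarrow> 0 \<le> x v"
    and n: "card V = n" "13 \<le> n"
    and mindeg: "\<And>v. v \<in> V \<Longrightarrow> 3 \<le> valency E v"
    and edges: "(\<Sum>v\<in>V. real (valency E v)) \<le> (real n)\<^sup>2 - 5 * real n + 10"
  shows "q \<le> 2 * real n - 6 + 6 / (real n - 1)"
proof (rule signless_eigen_le[OF x, where y = "\<lambda>v. real (valency E v)"])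
  fix v assume v: "v \<in> V"
  show "0 < real (valency E v)"
    using mindeg[OF v] by simp
  define d where "d = valency E v"
  have N: "E `` {v} \<subseteq> V - {v}"
    using arcs_subset no_loop by auto
  have deg_le: "valency E w \<le> n - 1" if "w \<in> V" for w
  proof -
    have "E `` {w} \<subseteq> V - {w}"
      using arcs_subset no_loop by auto
    then show ?thesis
      using card_mono[of "V - {w}" "E `` {w}"] finite_verts that n by auto
  qed
  let ?c = "2 * real n - 6 + 6 / (real n - 1)"
  have apply_eq: "signless_apply E (\<lambda>v. real (valency E v)) v
      = (real d)\<^sup>2 + (\<Sum>w\<in>E `` {v}. real (valency E w))"
    by (simp add: signless_apply_def d_def power2_eq_square)
  show "signless_apply E (\<lambda>v. real (valency E v)) v \<le> ?c * real (valency E v)"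
  proof (cases "d + 5 \<le> n")
    case True
    have "(\<Sum>w\<in>E `` {v}. real (valency E w)) \<le> real (card (E `` {v})) * (real n - 1)"
    proof (rule sum_bounded_above)
      fix w assume "w \<in> E `` {v}"
      then have "valency E w \<le> n - 1"
        using deg_le arcs_subset by auto
      then show "real (valency E w) \<le> real n - 1"
        using n(2) by linarith
    qed
    then have "signless_apply E (\<lambda>v. real (valency E v)) v \<le> real d * (real d + (real n - 1))"
      unfolding apply_eq d_def by (simp add: power2_eq_square algebra_simps)
    also have "\<dots> \<le> real d * ?c"
    proof (rule mult_left_mono)
      have "real d + 5 \<le> real n"
        using True by linarith
      moreover have "0 \<le> 6 / (real n - 1)"
        using n(2) by simp
      ultimately show "real d + (real n - 1) \<le> ?c"
        by linarith
    qed simp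
    finally show ?thesis
      by (simp add: d_def mult.commute)
  next
    case False
    \<comment> \<open>The number of non-neighbours; the estimate amounts to \<open>e (6 - e - 6/(n - 1)) \<ge> 0\<close>.\<close>
    define e where "e = real n - 1 - real d"
    have "d \<le> n - 1"
      using deg_le[OF v] by (simp add: d_def)
    then have e: "0 \<le> e" "e \<le> 3"
      using False n(2) unfolding e_def by linarith+
    have card_rest: "card (V - {v} - E `` {v}) = n - 1 - d"
      using N v finite_verts n(1) unfolding d_def by (subst card_Diff_subset) auto
    have "V = E `` {v} \<union> {v} \<union> (V - {v} - E `` {v})"
      using N v by auto
    then have "(\<Sum>w\<in>V. real (valency E w))
        = (\<Sum>w\<in>E `` {v} \<union> {v} \<union> (V - {v} - E `` {v}). real (valency E w))"
      by simp
    also have "\<dots> = (\<Sum>w\<in>E `` {v}. real (valency E w)) + real d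
        + (\<Sum>w\<in>V - {v} - E `` {v}. real (valency E w))"
      using no_loop finite_verts by (subst sum.union_disjoint; (subst sum.union_disjoint)?) (auto simp: d_def)
    finally have total: "(\<Sum>w\<in>V. real (valency E w)) = (\<Sum>w\<in>E `` {v}. real (valency E w)) + real d
        + (\<Sum>w\<in>V - {v} - E `` {v}. real (valency E w))" .
    have "real (n - 1 - d) * 3 \<le> (\<Sum>w\<in>V - {v} - E `` {v}. real (valency E w))"
      unfolding card_rest[symmetric] using mindeg by (intro sum_bounded_below) force
    moreover have "real (n - 1 - d) = e"
      using \<open>d \<le> n - 1\<close> n(2) by (simp add: e_def of_nat_diff)
    ultimately have "(\<Sum>w\<in>E `` {v}. real (valency E w)) \<le> (real n)\<^sup>2 - 5 * real n + 10 - real d - 3 * e"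
      using edges total by linarith
    then have "signless_apply E (\<lambda>v. real (valency E v)) v
        \<le> (real d)\<^sup>2 + ((real n)\<^sup>2 - 5 * real n + 10 - real d - 3 * e)"
      unfolding apply_eq by simp
    also have "\<dots> = (2 * real n - 6) * (real n - 1 - e) + 6 + (e\<^sup>2 - 6 * e)"
      unfolding e_def by (simp add: power2_eq_square algebra_simps)
    also have "e\<^sup>2 - 6 * e \<le> - e"
      using e mult_right_mono[of e 3 e] by (simp add: power2_eq_square)
    also have "- e \<le> - (6 * e / (real n - 1))"
      using e(1) n(2) mult_left_mono[of 6 "real n - 1" e] by (simp add: field_simps)
    also have "(2 * real n - 6) * (real n - 1 - e) + 6 + - (6 * e / (real n - 1))
        = ?c * (real n - 1 - e)"
      using n(2) by (simp add: field_simps)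
    also have "real n - 1 - e = real (valency E v)"
      unfolding e_def d_def by simp
    finally show ?thesis
      by simp
  qed
qed

text \<open>The Collatz-Wielandt bound with weight \<open>t\<close> on \<open>D\<close> and 1 elsewhere. The first condition on \<open>c\<close> is the
  worst case outside \<open>D\<close>, a vertex adjacent to all others. The second is the worst case in \<open>D\<close>, a
  vertex of degree \<open>r\<close> adjacent to everything outside \<open>D\<close>.\<close>
lemma radius_le_two_weights:
  fixes t :: real
  assumes x: "signless_eigen V E q x" "\<And>v. v \<in> V \<Longrightarrow> 0 \<le> x v"
    and D: "D \<subseteq> V" "card D = m" "card V = b + m" "\<And>v. v \<in> D \<Longrightarrow> valency E v \<le> r"
    and t: "0 < t" "t \<le> 1"
    and c: "2 * real b + real m - 2 + real m * t \<le> c" "2 * real r * t + (1 - t) * real b \<le> c * t"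
  shows "q \<le> c"
proof (rule signless_eigen_le[OF x, where y = "\<lambda>v. if v \<in> D then t else 1"])
  let ?y = "\<lambda>v. if v \<in> D then t else 1 :: real"
  fix v assume v: "v \<in> V"
  show "0 < ?y v"
    using t by simp
  let ?N = "E `` {v}"
  have N: "?N \<subseteq> V - {v}"
    using arcs_subset no_loop by auto
  have finD: "finite D"
    using D(1) finite_verts finite_subset by blast
  have "(\<Sum>w\<in>?N. ?y w) = (\<Sum>w\<in>?N. t) + (\<Sum>w\<in>?N. if w \<in> D then 0 else 1 - t)"
    unfolding sum.distrib[symmetric] by (intro sum.cong) auto
  also have "(\<Sum>w\<in>?N. if w \<in> D then 0 else 1 - t) = (1 - t) * real (card (?N - D))"
    by (simp add: sum.If_cases Diff_eq)
  finally have sum_y: "(\<Sum>w\<in>?N. ?y w) = t * real (valency E v) + (1 - t) * real (card (?N - D))"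
    by simp
  have card_VD: "card (V - D) = b"
    using D finD by (simp add: card_Diff_subset)
  show "signless_apply E ?y v \<le> c * ?y v"
  proof (cases "v \<in> D")
    case True
    have "card (?N - D) \<le> b"
      unfolding card_VD[symmetric] using N finite_verts by (intro card_mono) auto
    then have "(1 - t) * real (card (?N - D)) \<le> (1 - t) * real b"
      using t by (intro mult_left_mono) auto
    moreover have "t * real (valency E v) \<le> t * real r"
      using D(4)[OF True] t by (intro mult_left_mono) auto
    ultimately show ?thesis
      using c(2) True unfolding signless_apply_def sum_y by (simp add: algebra_simps)
  next
    case False
    have "card (?N - D) \<le> card (V - D - {v})"
      using N finite_verts by (intro card_mono) auto
    also have "\<dots> = b - 1"
      using card_VD v False finite_verts by simp
    finally have "card (?N - D) \<le> b - 1" .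
    moreover have "0 < b"
      using card_VD v False finite_verts by (metis DiffI card_gt_0_iff empty_iff finite_Diff)
    ultimately have "(1 - t) * real (card (?N - D)) \<le> (1 - t) * (real b - 1)"
      using t by (intro mult_left_mono) auto
    moreover have "valency E v \<le> b + m - 1"
      using card_mono[OF _ N] finite_verts v D(3) by auto
    then have "(1 + t) * real (valency E v) \<le> (1 + t) * (real b + real m - 1)"
      using t \<open>0 < b\<close> by (intro mult_left_mono) auto
    ultimately have "(1 + t) * real (valency E v) + (1 - t) * real (card (?N - D))
        \<le> 2 * real b + real m - 2 + real m * t"
      by (simp add: algebra_simps)
    then show ?thesis
      using c(1) False unfolding signless_apply_def sum_y by (simp add: algebra_simps)
  qed
qed

lemma degree_sum_le:
  assumes sets: "A \<subseteq> D" "D \<subseteq> V" "card A = k - 1" "card D = card V - k"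
    and k: "1 \<le> k" "2 * k \<le> card V"
    and deg: "\<And>v. v \<in> A \<Longrightarrow> valency E v \<le> k" "\<And>v. v \<in> D \<Longrightarrow> valency E v \<le> card V - k"
  shows "(\<Sum>v\<in>V. real (valency E v))
    \<le> (real k - 1) * k + (real (card V) - 2 * k + 1) * (real (card V) - k) + k * (real (card V) - 1)"
proof -
  define n where "n = card V"
  have fin: "finite D" "finite A"
    using finite_subset[OF sets(2) finite_verts] finite_subset[OF sets(1)] by auto
  have "(\<Sum>v\<in>V. real (valency E v)) = (\<Sum>v\<in>A \<union> (D - A) \<union> (V - D). real (valency E v))"
    using sets by (intro sum.cong) auto
  also have "\<dots> = (\<Sum>v\<in>A. real (valency E v)) + (\<Sum>v\<in>D - A. real (valency E v)) + (\<Sum>v\<in>V - D. real (valency E v))"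
    using fin finite_verts sets by (subst sum.union_disjoint; (subst sum.union_disjoint)?) auto
  also have "(\<Sum>v\<in>A. real (valency E v)) \<le> real (card A) * real k"
    using deg by (intro sum_bounded_above) auto
  also have "(\<Sum>v\<in>D - A. real (valency E v)) \<le> real (card (D - A)) * real (n - k)"
    using deg unfolding n_def by (intro sum_bounded_above) (metis DiffD1 of_nat_le_iff)
  also have "(\<Sum>v\<in>V - D. real (valency E v)) \<le> real (card (V - D)) * real (n - 1)"
  proof (rule sum_bounded_above)
    fix w assume "w \<in> V - D"
    moreover have "E `` {w} \<subseteq> V - {w}"
      using arcs_subset no_loop by auto
    ultimately show "real (valency E w) \<le> real (n - 1)"
      using card_mono[of "V - {w}" "E `` {w}"] finite_verts unfolding n_def by auto
  qed
  also have "card (D - A) = n - k - (k - 1)"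
    using sets fin unfolding n_def by (simp add: card_Diff_subset)
  also have "card (V - D) = k"
    using sets fin k unfolding n_def by (simp add: card_Diff_subset)
  finally show ?thesis
    using k sets(3) unfolding n_def by (simp add: of_nat_diff algebra_simps)
qed

end

text \<open>The claim amounts to \<open>3k\<^sup>2 - 3k - 10 \<le> 2n (k - 3)\<close>. From \<open>n \<ge> 2k\<close> it follows for \<open>k \<ge> 8\<close>. The remaining
  values of \<open>k\<close> are linear in \<open>n\<close>; for \<open>k = 4\<close> the condition is \<open>n \<ge> 13\<close>.\<close>
lemma degree_sum_bound_arith:
  fixes n k :: nat
  assumes k: "4 \<le> k" "2 * k \<le> n" and n: "13 \<le> n" and "(n, k) \<noteq> (13, 6)" "(n, k) \<noteq> (14, 7)"
  shows "(real k - 1) * k + (real n - 2 * k + 1) * (real n - k) + k * (real n - 1)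
    \<le> (real n)\<^sup>2 - 5 * real n + 10"
proof -
  have "3 * real k * k - 3 * k - 10 \<le> 2 * real n * (real k - 3)"
  proof (cases "8 \<le> k")
    case True
    have "2 * (2 * real k) * (real k - 3) \<le> 2 * real n * (real k - 3)"
      using k by (intro mult_right_mono) auto
    moreover have "8 * (real k - 8) \<le> real k * (real k - 8)"
      using True by (intro mult_right_mono) auto
    ultimately show ?thesis
      using True by (simp add: algebra_simps)
  next
    case False
    then consider "k = 4" | "k = 5" | "k = 6" "14 \<le> n" | "k = 7" "15 \<le> n"
      using assms by force
    then show ?thesis
      using n by cases auto
  qed
  then show ?thesis
    by (simp add: power2_eq_square algebra_simps)
qed

section \<open>Two vertices of degree three\<close>

lemma ex_top_subset:
  fixes x :: "'a \<Rightarrow> real"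
  assumes "finite I" "k \<le> card I"
  shows "\<exists>T\<subseteq>I. card T = k \<and> (\<forall>a\<in>T. \<forall>b\<in>I - T. x b \<le> x a)"
  using assms(2)
proof (induction k)
  case 0
  then show ?case
    by (intro exI[of _ "{}"]) auto
next
  case (Suc k)
  then obtain T where T: "T \<subseteq> I" "card T = k" "\<forall>a\<in>T. \<forall>b\<in>I - T. x b \<le> x a"
    by auto
  have fin: "finite T" "finite (I - T)"
    using assms(1) T(1) finite_subset by auto
  have "card (I - T) > 0"
    using T Suc.prems fin by (simp add: card_Diff_subset)
  then have "I - T \<noteq> {}"
    by (metis card.empty less_irrefl)
  then obtain m where m: "m \<in> I - T" "\<forall>b\<in>I - T. x b \<le> x m"
    using ex_maximizer[OF fin(2), of x] by blast
  have "card (insert m T) = Suc k"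
    using m T fin by simp
  then show ?case
    using m T by (intro exI[of _ "insert m T"]) auto
qed

text \<open>Swapping the elements of \<open>B\<close> outside \<open>T\<close> for those of \<open>T\<close> outside \<open>B\<close> does not decrease any summand.
  The constant \<open>c\<close> stands for the entry at a fixed end of the edges being moved.\<close>
lemma sum_le_top_subset:
  fixes x :: "'a \<Rightarrow> real"
  assumes fin: "finite I" and T: "T \<subseteq> I" "\<forall>a\<in>T. \<forall>b\<in>I - T. x b \<le> x a"
    and B: "B \<subseteq> I" "card B = card T"
    and x: "\<And>v. 0 \<le> x v" and c: "0 \<le> c"
  shows "(\<Sum>v\<in>B. (c + x v)\<^sup>2) \<le> (\<Sum>v\<in>T. (c + x v)\<^sup>2)"
proof -
  let ?g = "\<lambda>v. (c + x v)\<^sup>2"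
  have finBT: "finite B" "finite T"
    using finite_subset[OF B(1) fin] finite_subset[OF T(1) fin] by blast+
  have "card (B - T) = card (T - B)"
    using finBT B(2) card_Diff_subset_Int[of B T] card_Diff_subset_Int[of T B] by (simp add: Int_commute)
  then obtain h where h: "bij_betw h (B - T) (T - B)"
    using finBT finite_same_card_bij[of "B - T" "T - B"] by auto
  have "sum ?g (B - T) \<le> (\<Sum>v\<in>B - T. ?g (h v))"
  proof (rule sum_mono)
    fix v assume v: "v \<in> B - T"
    then have "h v \<in> T"
      using h by (auto simp: bij_betw_def)
    then have "x v \<le> x (h v)"
      using T v B(1) by auto
    then show "?g v \<le> ?g (h v)"
      using x c by (intro power_mono) auto
  qed
  also have "\<dots> = sum ?g (T - B)"
    by (rule sum.reindex_bij_betw[OF h])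
  finally have "sum ?g (B - T) \<le> sum ?g (T - B)" .
  then show ?thesis
    using sum.Int_Diff[OF finBT(1), of ?g T] sum.Int_Diff[OF finBT(2), of ?g B] by (simp add: Int_commute)
qed

context simple_graph
begin

text \<open>If two adjacent vertices of degree 3 are present, the edge \<open>uw\<close> is to be replaced by an edge from \<open>u\<close>
  to a vertex whose entry is at least that at \<open>w\<close>. The entry at a vertex of degree 3 is at
  most \<open>3 M / (q - 3)\<close>, where \<open>M\<close> is the largest entry. If no such vertex existed, all but two entries
  would be this small, and the eigenvalue equation at a vertex with entry \<open>M\<close> would force \<open>q\<close> to be
  only slightly larger than \<open>n\<close>, far below \<open>2n - 6\<close>.\<close>
lemma ex_larger_nonneighbour:
  assumes x: "signless_eigen V E q x" "\<And>v. 0 \<le> x v"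
    and q: "2 * real n - 6 \<le> q" and n: "card V = n" "13 \<le> n"
    and uw: "(u, w) \<in> E" "valency E u = 3" "valency E w = 3"
  shows "\<exists>a\<in>V - {u, w} - E `` {u}. x w \<le> x a"
proof (rule ccontr)
  assume "\<not> ?thesis"
  then have less: "x a \<le> x w" if "a \<in> V - {u, w} - E `` {u}" for a
  proof -
    have "\<not> x w \<le> x a"
      using \<open>\<not> (\<exists>a\<in>V - {u, w} - E `` {u}. x w \<le> x a)\<close> that by blast
    then show ?thesis
      by simp
  qed
  have uwV: "u \<in> V" "w \<in> V" "u \<noteq> w"
    using uw arcs_subset no_loop by auto
  obtain z where z: "z \<in> V" "\<And>v. v \<in> V \<Longrightarrow> x v \<le> x z"
    using ex_maximizer[OF finite_verts, of x] uwV(1) by blast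
  define M where "M = x z"
  obtain v0 where "v0 \<in> V" "x v0 \<noteq> 0"
    using x(1) by (auto simp: signless_eigen_def)
  then have M: "0 < M"
    using x(2)[of v0] z(2)[of v0] unfolding M_def by simp
  have eq: "q * x v = real (valency E v) * x v + (\<Sum>w\<in>E `` {v}. x w)" if "v \<in> V" for v
    using x(1) that by (simp add: signless_eigen_def signless_apply_def)
  have q3: "q - 3 > 0"
    using q n(2) by linarith
  define s where "s = 3 * M / (q - 3)"
  have s: "0 \<le> s"
    using M q3 unfolding s_def by simp
  have small: "x v \<le> s" if "v \<in> V" "valency E v = 3" for v
  proof -
    have "(\<Sum>w\<in>E `` {v}. x w) \<le> real (card (E `` {v})) * M"
      using z(2) arcs_subset unfolding M_def by (intro sum_bounded_above) auto
    then have "x v * (q - 3) \<le> 3 * M"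
      using eq[OF that(1)] that(2) by (simp add: algebra_simps)
    then show ?thesis
      using q3 unfolding s_def by (simp add: field_simps)
  qed
  \<comment> \<open>The exceptional vertices are the two neighbours of \<open>u\<close> other than \<open>w\<close>.\<close>
  have bound: "x v \<le> s + (if v \<in> E `` {u} - {w} then M else 0)" if v: "v \<in> V" for v
  proof (cases "v \<in> E `` {u} - {w}")
    case True
    then show ?thesis
      using z(2)[OF v] s unfolding M_def by simp
  next
    case False
    then consider "v = u" | "v = w" | "v \<in> V - {u, w} - E `` {u}"
      using v by blast
    then have "x v \<le> s"
      using small[OF uwV(1) uw(2)] small[OF uwV(2) uw(3)] less[of v] by cases auto
    then show ?thesis
      by (simp only: False if_False add_0_right)
  qed
  define B where "B = E `` {u} - {w}"
  have "card B = 2"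
    using uw unfolding B_def by simp
  moreover have "V \<inter> B = B"
    using arcs_subset unfolding B_def by auto
  ultimately have "(\<Sum>v\<in>V. s + (if v \<in> B then M else 0)) = real n * s + 2 * M"
    using finite_verts n(1) by (simp add: sum.distrib sum.If_cases)
  then have "(\<Sum>v\<in>V. x v) \<le> real n * s + 2 * M"
    using sum_mono[of V x, OF bound] unfolding B_def by simp
  moreover have "(\<Sum>v\<in>E `` {z}. x v) \<le> (\<Sum>v\<in>V. x v)"
    using arcs_subset x(2) finite_verts by (intro sum_mono2) auto
  moreover have "real (valency E z) * M \<le> real n * M"
  proof (intro mult_right_mono)
    show "real (valency E z) \<le> real n"
      using card_mono[OF finite_verts, of "E `` {z}"] arcs_subset n(1) by auto
  qed (use M in simp)
  ultimately have "q * M \<le> real n * M + real n * s + 2 * M"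
    using eq[OF z(1)] unfolding M_def by linarith
  then have "(q - real n - 2) * M \<le> 3 * real n * M / (q - 3)"
    unfolding s_def by (simp add: algebra_simps)
  then have "(q - real n - 2) * (q - 3) * M \<le> 3 * real n * M"
    using q3 by (simp add: field_simps)
  then have "(q - real n - 2) * (q - 3) \<le> 3 * real n"
    using M mult_le_cancel_right_pos by blast
  moreover have "(real n - 8) * (2 * real n - 9) \<le> (q - real n - 2) * (q - 3)"
    using q n(2) by (intro mult_mono) auto
  moreover have "5 * (2 * real n - 9) \<le> (real n - 8) * (2 * real n - 9)"
    using n(2) by (intro mult_right_mono) auto
  ultimately have "5 * (2 * real n - 9) \<le> 3 * real n"
    by (meson order.trans)
  then show False
    using n(2) by simp
qed

text \<open>The rewiring step: the edges at \<open>u\<close> and \<open>w\<close> are moved to the top set \<open>T\<close>. If \<open>u\<close> and \<open>w\<close> are not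
  adjacent, both neighbourhoods are triples and \<open>sum_le_top_subset\<close> applies. If they are adjacent,
  the edge \<open>uw\<close> is first traded for an edge from \<open>u\<close> to a vertex with at least the entry at \<open>w\<close>, and \<open>w\<close>
  gains an arbitrary third neighbour; where the entry at \<open>w\<close> is positive,
  this new edge makes the inequality strict.\<close>
lemma cross_terms_le_top:
  assumes x: "signless_eigen V E q x" "\<And>v. 0 \<le> x v"
    and q: "2 * real n - 6 \<le> q" and n: "card V = n" "13 \<le> n"
    and uw: "u \<in> V" "w \<in> V" "u \<noteq> w" "valency E u = 3" "valency E w = 3"
    and T: "T \<subseteq> V - {u, w}" "card T = 3" "\<forall>a\<in>T. \<forall>b\<in>V - {u, w} - T. x b \<le> x a"
  defines "L \<equiv> 2 * (\<Sum>p\<in>{u, w}. \<Sum>v\<in>E `` {p} - {u, w}. (x p + x v)\<^sup>2)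
      + (\<Sum>(p, v)\<in>E \<inter> {u, w} \<times> {u, w}. (x p + x v)\<^sup>2)"
    and "R \<equiv> 2 * (\<Sum>p\<in>{u, w}. \<Sum>v\<in>T. (x p + x v)\<^sup>2)"
  shows "L \<le> R" and "(u, w) \<in> E \<Longrightarrow> 0 < x w \<Longrightarrow> L < R"
proof -
  have fin: "finite (V - {u, w})"
    using finite_verts by simp
  have top: "(\<Sum>v\<in>B. (x p + x v)\<^sup>2) \<le> (\<Sum>v\<in>T. (x p + x v)\<^sup>2)"
    if "B \<subseteq> V - {u, w}" "card B = 3" for B p
    using sum_le_top_subset[OF fin T(1) T(3), of B "x p"] that T(2) x(2) by simp
  have adj: "L \<le> R - 2 * (x w)\<^sup>2" if uw_arc: "(u, w) \<in> E"
  proof -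
    have wu: "(w, u) \<in> E"
      using uw_arc arcs_sym_iff[of u w] by simp
    have "E `` {u} - {u, w} = E `` {u} - {w}" "E `` {w} - {u, w} = E `` {w} - {u}"
      using no_loop by auto
    then have cards: "card (E `` {u} - {u, w}) = 2" "card (E `` {w} - {u, w}) = 2"
      using uw(4,5) uw_arc wu by simp_all
    \<comment> \<open>With \<open>a\<close> and \<open>b\<close> added, the neighbourhoods of \<open>u\<close> and \<open>w\<close> outside \<open>{u, w}\<close> become triples.\<close>
    obtain a where a: "a \<in> V - {u, w} - E `` {u}" "x w \<le> x a"
      using ex_larger_nonneighbour[OF x q n uw_arc uw(4,5)] by blast
    have "card (V - {u, w}) = n - 2"
      using uw n(1) finite_verts by (simp add: card_Diff_subset)
    then have "card (V - {u, w}) \<noteq> card (E `` {w} - {u, w})"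
      using cards(2) n(2) by linarith
    then have "V - {u, w} \<noteq> E `` {w} - {u, w}"
      by metis
    then obtain b where b: "b \<in> V - {u, w} - E `` {w}"
      using arcs_subset by blast
    have "(x u + x w)\<^sup>2 \<le> (x u + x a)\<^sup>2"
      using a(2) x(2) by (intro power_mono) auto
    moreover have "(\<Sum>v\<in>insert a (E `` {u} - {u, w}). (x u + x v)\<^sup>2) \<le> (\<Sum>v\<in>T. (x u + x v)\<^sup>2)"
      using a(1) cards arcs_subset by (intro top) auto
    then have "(x u + x a)\<^sup>2 + (\<Sum>v\<in>E `` {u} - {u, w}. (x u + x v)\<^sup>2) \<le> (\<Sum>v\<in>T. (x u + x v)\<^sup>2)"
      using a(1) by simp
    moreover have "(x w)\<^sup>2 \<le> (x w + x b)\<^sup>2"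
      using x(2) by (intro power_mono) auto
    moreover have "(\<Sum>v\<in>insert b (E `` {w} - {u, w}). (x w + x v)\<^sup>2) \<le> (\<Sum>v\<in>T. (x w + x v)\<^sup>2)"
      using b cards arcs_subset by (intro top) auto
    then have "(x w + x b)\<^sup>2 + (\<Sum>v\<in>E `` {w} - {u, w}. (x w + x v)\<^sup>2) \<le> (\<Sum>v\<in>T. (x w + x v)\<^sup>2)"
      using b by simp
    moreover have "E \<inter> {u, w} \<times> {u, w} = {(u, w), (w, u)}"
      using uw_arc wu no_loop by auto
    then have "(\<Sum>(p, v)\<in>E \<inter> {u, w} \<times> {u, w}. (x p + x v)\<^sup>2) = 2 * (x u + x w)\<^sup>2"
      using uw(3) by (simp add: add.commute)
    ultimately show ?thesis
      using uw(3) unfolding L_def R_def by simp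
  qed
  show "L < R" if "(u, w) \<in> E" "0 < x w"
    using adj[OF that(1)] that(2) zero_less_power[OF that(2), of 2] by linarith
  show "L \<le> R"
  proof (cases "(u, w) \<in> E")
    case True
    then show ?thesis
      using adj by (smt (verit) zero_le_power2)
  next
    case False
    then have "(w, u) \<notin> E"
      using arcs_sym_iff[of u w] by simp
    then have "E \<inter> {u, w} \<times> {u, w} = {}" "E `` {u} - {u, w} = E `` {u}" "E `` {w} - {u, w} = E `` {w}"
      and "E `` {u} \<subseteq> V - {u, w}" "E `` {w} \<subseteq> V - {u, w}"
      using False no_loop arcs_subset by auto
    then show ?thesis
      using top[of "E `` {u}" u] top[of "E `` {w}" w] uw(3,4,5) unfolding L_def R_def by simp
  qed
qed

end

text \<open>The case \<open>k = 3\<close> of the degree condition. Comparing the form of \<open>G\<close> with that of the rewired copy of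
  \<open>S\<^sub>n\<^sup>3\<close> at an eigenvector of \<open>G\<close> gives a chain of inequalities that starts and ends with the same
  number, so every step is an equality.\<close>
theorem iso_S3_if_two_cubic_vertices:
  assumes G: "pair_graph G" and n: "card (pverts G) = n" "13 \<le> n"
    and mindeg: "\<And>v. v \<in> pverts G \<Longrightarrow> 3 \<le> valency (parcs G) v"
    and radius: "signless_laplacian_radius (S3 n) \<le> signless_laplacian_radius G"
    and A: "A \<subseteq> pverts G" "card A = 2" "\<And>v. v \<in> A \<Longrightarrow> valency (parcs G) v \<le> 3"
    and D: "D \<subseteq> pverts G" "card D = n - 3" "\<And>v. v \<in> D \<Longrightarrow> valency (parcs G) v \<le> n - 3"
  shows "digraph_iso (with_proj G) (with_proj (S3 n))"
proof -
  let ?V = "pverts G" and ?E = "parcs G" and ?q = "signless_laplacian_radius G"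
  let ?qS = "signless_laplacian_radius (S3 n)"
  interpret simple_graph ?V ?E
    using G by (rule simple_graph_pair_graph)
  have ne: "?V \<noteq> {}"
    using n by auto
  obtain x where x: "\<And>v. 0 \<le> x v" "signless_eigen ?V ?E ?q x"
    using signless_laplacian_radius_properties(1)[OF G ne] by blast
  have "0 \<le> 6 / (real n - 2)"
    using n(2) by simp
  then have q: "2 * real n - 6 \<le> ?q"
    using radius_S3_ge[of n] n(2) radius by linarith
  obtain u w where uw: "A = {u, w}" "u \<noteq> w"
    using A(2) by (meson card_2_iff)
  have uwV: "u \<in> ?V" "w \<in> ?V"
    using A(1) uw by auto
  have deg3: "valency ?E u = 3" "valency ?E w = 3"
    using A(3) mindeg uwV uw by (auto intro!: antisym)
  let ?I = "?V - {u, w}"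
  have card_I: "card ?I = n - 2"
    using uw uwV n(1) finite_verts by (simp add: card_Diff_subset)
  have "\<exists>T\<subseteq>?I. card T = 3 \<and> (\<forall>a\<in>T. \<forall>b\<in>?I - T. x b \<le> x a)"
    by (rule ex_top_subset) (use finite_verts card_I n(2) in auto)
  then obtain T where T: "T \<subseteq> ?I" "card T = 3" "\<forall>a\<in>T. \<forall>b\<in>?I - T. x b \<le> x a"
    by blast
  let ?S = "join_arcs ?V T {u, w}"
  let ?g = "\<lambda>(v, w). (x v + x w)\<^sup>2"
  let ?cross = "2 * (\<Sum>p\<in>{u, w}. \<Sum>v\<in>?E `` {p} - {u, w}. (x p + x v)\<^sup>2)
      + (\<Sum>(p, v)\<in>?E \<inter> {u, w} \<times> {u, w}. (x p + x v)\<^sup>2)"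
  let ?crossS = "2 * (\<Sum>p\<in>{u, w}. \<Sum>v\<in>T. (x p + x v)\<^sup>2)"
  have form_G: "arc_form ?E x = sum ?g (?E \<inter> ?I \<times> ?I) + ?cross"
    using arc_form_split[of "{u, w}" x] uwV by simp
  have form_S: "arc_form ?S x = sum ?g (?I \<times> ?I - Id) + ?crossS"
    by (rule arc_form_join_arcs) (use finite_verts uwV T in auto)
  have inner_sub: "?E \<inter> ?I \<times> ?I \<subseteq> ?I \<times> ?I - Id"
    using no_loop by auto
  have fin_inner: "finite (?I \<times> ?I - Id)"
    using finite_verts by simp
  have inner: "sum ?g (?E \<inter> ?I \<times> ?I) \<le> sum ?g (?I \<times> ?I - Id)"
    by (rule sum_mono2[OF fin_inner inner_sub]) auto
  note cross = cross_terms_le_top[OF x(2,1) q n uwV uw(2) deg3 T]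
  have T': "T \<subseteq> ?V" "{u, w} \<subseteq> ?V" "card {u, w} = 2" "T \<inter> {u, w} = {}"
    using T uw uwV by auto
  note S_bound = arc_form_join_le_radius_S3[OF finite_verts n(1) _ T'(1) T(2) T'(2-4)]
  have n5: "5 \<le> n"
    using n(2) by simp
  have form_eq: "arc_form ?E x = 2 * ?q * sq_norm_on ?V x"
    by (rule arc_form_eigen[OF x(2)])
  have "0 \<le> sq_norm_on ?V x"
    unfolding sq_norm_on_def by (intro sum_nonneg) auto
  then have "2 * ?qS * sq_norm_on ?V x \<le> arc_form ?E x"
    unfolding form_eq using radius by (simp add: mult_right_mono)
  then have chain: "arc_form ?S x \<le> arc_form ?E x" "2 * ?qS * sq_norm_on ?V x \<le> arc_form ?S x"
    using S_bound(1)[OF n5, of x] inner cross(1) unfolding form_G form_S by linarith+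
  have pos: "0 < x v" if "v \<in> ?V" for v
    using S_bound(2)[OF n5 chain(2) x(1) _ that] x(2) by (auto simp: signless_eigen_def)
  have uw_nonadj: "(u, w) \<notin> ?E"
    using chain(1) inner cross(2) pos[OF uwV(2)] unfolding form_G form_S by linarith
  have inner_full: "?E \<inter> ?I \<times> ?I = ?I \<times> ?I - Id"
  proof (rule ccontr)
    assume "?E \<inter> ?I \<times> ?I \<noteq> ?I \<times> ?I - Id"
    then obtain a b where ab: "(a, b) \<in> ?I \<times> ?I - Id" "(a, b) \<notin> ?E \<inter> ?I \<times> ?I"
      using inner_sub by auto
    have "0 < x a + x b"
      using pos[of a] pos[of b] ab(1) by auto
    then have "sum ?g (?E \<inter> ?I \<times> ?I) < sum ?g (?I \<times> ?I - Id)"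
      using ab by (intro sum_strict_mono2[OF fin_inner inner_sub, of "(a, b)"]) auto
    then show False
      using chain(1) cross(1) unfolding form_G form_S by linarith
  qed
  have wu_nonadj: "(w, u) \<notin> ?E"
    using uw_nonadj arcs_sym_iff[of u w] by simp
  have nbrs: "?E `` {p} = ?V - D" if p: "p \<in> {u, w}" for p
  proof (rule card_subset_eq)
    show "finite (?V - D)"
      using finite_verts by simp
    have "card (?V - D) = 3"
      using D(1,2) n finite_subset[OF D(1) finite_verts] by (simp add: card_Diff_subset)
    then show "card (?E `` {p}) = card (?V - D)"
      using p deg3 by auto
    show "?E `` {p} \<subseteq> ?V - D"
    proof
      fix v assume v: "v \<in> ?E `` {p}"
      then have vI: "v \<in> ?I"
        using p arcs_subset no_loop uw_nonadj wu_nonadj by auto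
      have "(?I - {v}) \<subseteq> ?E `` {v}"
        using inner_full vI by auto
      moreover have "p \<in> ?E `` {v}"
        using v arcs_sym_iff[of p v] by simp
      ultimately have "insert p (?I - {v}) \<subseteq> ?E `` {v}"
        by blast
      then have "card (insert p (?I - {v})) \<le> valency ?E v"
        by (rule card_mono[OF finite_neighbours])
      moreover have "card (insert p (?I - {v})) = n - 2"
        using p vI card_I finite_verts n(2) by auto
      ultimately have "v \<notin> D"
        using D(3)[of v] n(2) by auto
      then show "v \<in> ?V - D"
        using vI by auto
    qed
  qed
  let ?K = "?V - D"
  have K: "?K \<subseteq> ?V" "card ?K = 3" "?K \<inter> {u, w} = {}"
    using nbrs[of u] deg3(1) no_loop uw_nonadj by auto
  have "(a, b) \<in> ?E \<longleftrightarrow> (a, b) \<in> join_arcs ?V ?K {u, w}" for a b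
  proof -
    consider "a \<in> {u, w}" | "b \<in> {u, w}" "a \<notin> {u, w}" | "a \<notin> {u, w}" "b \<notin> {u, w}"
      by blast
    then show ?thesis
    proof cases
      case 1
      then have "(a, b) \<in> ?E \<longleftrightarrow> b \<in> ?K"
        using nbrs[of a] by auto
      then show ?thesis
        using 1 K uwV unfolding join_arcs_def by auto
    next
      case 2
      then have "(a, b) \<in> ?E \<longleftrightarrow> a \<in> ?K"
        using nbrs[of b] arcs_sym_iff[of a b] by auto
      then show ?thesis
        using 2 K uwV unfolding join_arcs_def by auto
    next
      case 3
      then have "(a, b) \<in> ?E \<longleftrightarrow> (a, b) \<in> ?I \<times> ?I - Id"
        using inner_full arcs_subset by blast
      then show ?thesis
        using 3 unfolding join_arcs_def by auto
    qed
  qed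
  then have "?E = join_arcs ?V ?K {u, w}"
    by auto
  then show ?thesis
    by (rule digraph_iso_S3[OF G _ n(1) n5 K(1,2) T'(2,3) K(3)])
qed

section \<open>Signless Laplacian radius and Hamilton-connectedness\<close>

theorem corollary1p11:
  fixes G :: "'a pair_pre_digraph" and n :: nat
  assumes "pair_graph G"
    and "Digraph_Component.connected (with_proj G)"
    and "card (pverts G) = n"
    and "n \<ge> 13"
    and "min_degree G \<ge> 3"
    and "signless_laplacian_radius G \<ge> signless_laplacian_radius (S3 n)"
    and "\<not> digraph_iso (with_proj G) (with_proj (S3 n))"
  shows "hamilton_connected G"
proof (rule ccontr)
  assume "\<not> hamilton_connected G"
  then have not_hc: "\<not> ham_conn (pverts G) (parcs G)"
    using hamilton_connected_if_ham_conn by blast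
  let ?V = "pverts G" and ?E = "parcs G" and ?q = "signless_laplacian_radius G"
  interpret simple_graph ?V ?E
    using assms(1) by (rule simple_graph_pair_graph)
  have mindeg: "3 \<le> valency ?E v" if "v \<in> ?V" for v
  proof -
    have "min_degree G \<le> out_degree (with_proj G) v"
      unfolding min_degree_def using that finite_verts by (intro Min_le) auto
    then show ?thesis
      using assms(5) by (simp add: out_degree_with_proj)
  qed
  obtain k A D where k: "3 \<le> k" "2 * k \<le> n"
    and A: "A \<subseteq> D" "card A = k - 1" "\<And>v. v \<in> A \<Longrightarrow> valency ?E v \<le> k"
    and D: "D \<subseteq> ?V" "card D = n - k" "\<And>v. v \<in> D \<Longrightarrow> valency ?E v \<le> n - k"
    using low_degrees_if_not_ham_conn[OF not_hc mindeg] assms(3) by (metis zero_less_numeral)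
  have "k \<noteq> 3"
  proof
    assume "k = 3"
    then have "digraph_iso (with_proj G) (with_proj (S3 n))"
      using A D by (intro iso_S3_if_two_cubic_vertices[OF assms(1,3,4) mindeg assms(6), where A = A and D = D]) auto
    then show False
      using assms(7) by blast
  qed
  with k(1) have k4: "4 \<le> k"
    by simp
  have "?V \<noteq> {}"
    using assms(3,4) by auto
  then obtain x where x: "signless_eigen ?V ?E ?q x" "\<And>v. 0 \<le> x v"
    using signless_laplacian_radius_properties(1)[OF assms(1)] by blast
  have q_ge: "2 * real n - 6 + 6 / (real n - 2) \<le> ?q"
    using radius_S3_ge[of n] assms(4,6) by linarith
  consider "n = 13" "k = 6" | "n = 14" "k = 7" | "(n, k) \<noteq> (13, 6)" "(n, k) \<noteq> (14, 7)"
    by blast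
  then show False
  proof cases
    case 1
    \<comment> \<open>This is below \<open>20 + 6/11\<close>, the lower bound for \<open>S\<^sub>n\<^sup>3\<close>.\<close>
    have "?q \<le> 41 / 2"
      by (rule radius_le_two_weights[OF x(1) x(2) D(1), where t = "1 / 2" and b = 6 and m = 7 and r = 7])
        (use D assms(3) 1 in auto)
    then show False
      using q_ge 1 by simp
  next
    case 2
    \<comment> \<open>Weight 1/2 would give exactly the lower bound 22.5 for \<open>S\<^sub>n\<^sup>3\<close>; a slightly smaller weight gains the strictness.\<close>
    have "?q \<le> 112 / 5"
      by (rule radius_le_two_weights[OF x(1) x(2) D(1), where t = "12 / 25" and b = 7 and m = 7 and r = 7])
        (use D assms(3) 2 in auto)
    then show False
      using q_ge 2 by simp
  next
    case 3
    have "(\<Sum>v\<in>?V. real (valency ?E v)) \<le> (real n)\<^sup>2 - 5 * real n + 10"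
      using degree_sum_le[OF A(1) D(1) A(2)] degree_sum_bound_arith[OF k4 k(2) assms(4) 3]
        A(3) D(2,3) k assms(3) by fastforce
    then have "?q \<le> 2 * real n - 6 + 6 / (real n - 1)"
      by (intro radius_le_if_few_edges[OF x(1) x(2) assms(3,4) mindeg])
    moreover have "6 / (real n - 1) < 6 / (real n - 2)"
      using assms(4) by (intro divide_strict_left_mono) auto
    ultimately show False
      using q_ge by linarith
  qed
qed

end
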